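(* Let $0<\beta<1$ and let $h\in\mathbb{W}$. If the measures $\mu_\beta$ and $\mu_\beta^h$ are equivalent (mutually absolutely continuous), then $h\in\mathcal{H}_{1/2}$.
   Context: $\mathbb{R}^+=[0,\infty)$. $\mathbb{W}$ is the space of continuous $w:\mathbb{R}^+\to\mathbb{R}$ with $w(0)=0$, with the topology of locally uniform convergence and Borel $\sigma$-algebra $\mathcal{B}(\mathbb{W})$; $\mathbb{P}_{1/2}$ is Wiener measure on $\mathbb{W}$. $\mathbb{P}_{Y_\beta}$ is the probability measure on $\mathbb{R}^+$ with density $M_\beta$ determined by $\int_0^\infty e^{-s\tau}M_\beta(\tau)\,d\tau=E_\beta(-s)$, $s\ge0$, with $E_\beta(z)=\sum_{n\ge0}z^n/\Gamma(\beta n+1)$. On $(\mathbb{W}\times\mathbb{R}^+,\mathcal{B}(\mathbb{W})\otimes\mathcal{B}(\mathbb{R}^+),\mathbb{P}_{1/2}\otimes\mathbb{P}_{Y_\beta})$ let $X_\beta(t)(w,\tau)=w(t\tau)$ and, for $h\in\mathbb{W}$, $X_\beta^h(t)(w,\tau)=w(t\tau)+h(t\tau)$, $t\ge0$. Their laws on $\mathbb{W}$ are $\mu_\beta$ and $\mu_\beta^h$. $\mathcal{H}_{1/2}$ is the space of functions $h(t)=\int_0^t\dot h(s)\,\mathrm{d}s$, $t\ge0$, with $\dot h\in L^2(\mathbb{R}^+)$ (Lebesgue measure). *)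

theory Defs
  imports "HOL-Probability.Probability"
begin

text \<open>Paths are functions on \<open>real\<close> restricted to the half-line in the sense of
  \<^const>\<open>restrict\<close>: they take the value \<^const>\<open>undefined\<close> at negative times, so that
  equality of paths is equality on \<open>{0..}\<close>.\<close>

definition path_space :: "(real \<Rightarrow> real) set" where
  "path_space = {w \<in> extensional {0..}. continuous_on {0..} w \<and> w 0 = 0}"

text \<open>Locally uniform convergence: the sets of all paths uniformly \<open>e\<close>-close to \<open>w\<close> on \<open>{0..T}\<close>
  form a neighbourhood base at \<open>w\<close>.\<close>

definition path_topology :: "(real \<Rightarrow> real) topology" where
  "path_topology = topology (\<lambda>U. U \<subseteq> path_space \<and>
     (\<forall>w\<in>U. \<exists>T. \<exists>e>0. \<forall>v\<in>path_space. (\<forall>t\<in>{0..T}. \<bar>v t - w t\<bar> < e) \<longrightarrow> v \<in> U))"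

lemma openin_path_topology:
  "openin path_topology U \<longleftrightarrow> U \<subseteq> path_space \<and>
     (\<forall>w\<in>U. \<exists>T. \<exists>e>0. \<forall>v\<in>path_space. (\<forall>t\<in>{0..T}. \<bar>v t - w t\<bar> < e) \<longrightarrow> v \<in> U)"
proof -
  let ?nb = "\<lambda>U w. \<exists>T. \<exists>e>0. \<forall>v\<in>path_space. (\<forall>t\<in>{0..T}. \<bar>v t - w t\<bar> < e) \<longrightarrow> v \<in> U"
  have int: "?nb (A \<inter> B) w" if A: "?nb A w" and B: "?nb B w" for A B :: "(real \<Rightarrow> real) set" and w
  proof -
    obtain T e where 1: "e > 0" "\<And>v. v \<in> path_space \<Longrightarrow> \<forall>t\<in>{0..T}. \<bar>v t - w t\<bar> < e \<Longrightarrow> v \<in> A"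
      using A by blast
    obtain T' e' where 2: "e' > 0"
      "\<And>v. v \<in> path_space \<Longrightarrow> \<forall>t\<in>{0..T'}. \<bar>v t - w t\<bar> < e' \<Longrightarrow> v \<in> B"
      using B by blast
    have "v \<in> A \<inter> B"
      if v: "v \<in> path_space" "\<forall>t\<in>{0..max T T'}. \<bar>v t - w t\<bar> < min e e'" for v
    proof
      show "v \<in> A" by (rule 1(2)[OF v(1)]) (use v(2) in auto)
      show "v \<in> B" by (rule 2(2)[OF v(1)]) (use v(2) in auto)
    qed
    moreover have "min e e' > 0" using 1(1) 2(1) by simp
    ultimately show ?thesis by blast
  qed
  have un: "?nb (\<Union>K) w" if "A \<in> K" "?nb A w" for A K w
    using that by (meson UnionI)
  have "istopology (\<lambda>U. U \<subseteq> path_space \<and> (\<forall>w\<in>U. ?nb U w))"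
    unfolding istopology_def
  proof (intro conjI allI impI)
    fix A B assume AB: "A \<subseteq> path_space \<and> (\<forall>w\<in>A. ?nb A w)" "B \<subseteq> path_space \<and> (\<forall>w\<in>B. ?nb B w)"
    show "A \<inter> B \<subseteq> path_space" using AB by blast
    show "\<forall>w\<in>A \<inter> B. ?nb (A \<inter> B) w"
    proof
      fix w assume "w \<in> A \<inter> B"
      then show "?nb (A \<inter> B) w" using AB by (intro int) auto
    qed
  next
    fix K assume K: "\<forall>A\<in>K. A \<subseteq> path_space \<and> (\<forall>w\<in>A. ?nb A w)"
    then show "\<Union>K \<subseteq> path_space" by blast
    show "\<forall>w\<in>\<Union>K. ?nb (\<Union>K) w" using K un by (metis (no_types, lifting) UnionE)
  qed
  then show ?thesis
    unfolding path_topology_def by (simp add: topology_inverse')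
qed

definition path_borel :: "(real \<Rightarrow> real) measure" where
  "path_borel = sigma path_space {U. openin path_topology U}"

text \<open>Wiener measure, characterised by independent increments with \<open>w t - w s\<close> distributed
  according to \<open>N(0, t - s)\<close>. The parameter of \<^const>\<open>normal_density\<close> is the standard deviation;
  \<open>w 0 = 0\<close> and continuity are part of \<^const>\<open>path_space\<close>.\<close>

definition wiener_measure :: "(real \<Rightarrow> real) measure \<Rightarrow> bool" where
  "wiener_measure P \<longleftrightarrow>
     prob_space P \<and> sets P = sets path_borel \<and>
     (\<forall>s t. 0 \<le> s \<longrightarrow> s < t \<longrightarrow>
        distributed P lborel (\<lambda>w. w t - w s) (\<lambda>x. ennreal (normal_density 0 (sqrt (t - s)) x))) \<and>
     (\<forall>(n::nat) t. 0 \<le> t 0 \<longrightarrow> (\<forall>i<n. t i < t (Suc i)) \<longrightarrow>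
        prob_space.indep_vars P (\<lambda>_. borel) (\<lambda>i w. w (t (Suc i)) - w (t i)) {..<n})"

definition mittag_leffler :: "real \<Rightarrow> real \<Rightarrow> real" where
  "mittag_leffler \<beta> z = (\<Sum>n. z ^ n / Gamma (\<beta> * real n + 1))"

text \<open>The law of \<open>Y\<^sub>\<beta>\<close> on the half-line: the measure whose density \<open>M\<close> has Laplace transform
  \<open>s \<mapsto> E\<^sub>\<beta>(-s)\<close>. The case \<open>s = 0\<close> says that the total mass is \<open>1\<close>.\<close>

definition Y_law :: "real \<Rightarrow> real measure \<Rightarrow> bool" where
  "Y_law \<beta> Q \<longleftrightarrow>
     (\<exists>M \<in> borel_measurable (restrict_space lborel {0..}).
        (\<forall>\<tau>\<ge>0. 0 \<le> M \<tau>) \<and>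
        (\<forall>s\<ge>0. has_bochner_integral (restrict_space lborel {0..})
                  (\<lambda>\<tau>. exp (- (s * \<tau>)) * M \<tau>) (mittag_leffler \<beta> (- s))) \<and>
        Q = density (restrict_space lborel {0..}) (\<lambda>\<tau>. ennreal (M \<tau>)))"

definition X_path :: "(real \<Rightarrow> real) \<times> real \<Rightarrow> real \<Rightarrow> real" where
  "X_path = (\<lambda>(w, \<tau>). \<lambda>t\<in>{0..}. w (t * \<tau>))"

definition X_shifted_path :: "(real \<Rightarrow> real) \<Rightarrow> (real \<Rightarrow> real) \<times> real \<Rightarrow> real \<Rightarrow> real" where
  "X_shifted_path h = (\<lambda>(w, \<tau>). \<lambda>t\<in>{0..}. w (t * \<tau>) + h (t * \<tau>))"

definition X_law :: "(real \<Rightarrow> real) measure \<Rightarrow> real measure \<Rightarrow> (real \<Rightarrow> real) measure" where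
  "X_law P Q = distr (P \<Otimes>\<^sub>M Q) path_borel X_path"

definition X_shifted_law ::
    "(real \<Rightarrow> real) measure \<Rightarrow> real measure \<Rightarrow> (real \<Rightarrow> real) \<Rightarrow> (real \<Rightarrow> real) measure" where
  "X_shifted_law P Q h = distr (P \<Otimes>\<^sub>M Q) path_borel (X_shifted_path h)"

definition equivalent_measures :: "'a measure \<Rightarrow> 'a measure \<Rightarrow> bool" where
  "equivalent_measures M N \<longleftrightarrow> absolutely_continuous M N \<and> absolutely_continuous N M"

definition cameron_martin_space :: "(real \<Rightarrow> real) set" where
  "cameron_martin_space =
     {h. \<exists>g \<in> borel_measurable (lebesgue_on {0..}).
           integrable (lebesgue_on {0..}) (\<lambda>s. (g s)\<^sup>2) \<and>
           h = (\<lambda>t\<in>{0..}. LINT s|lebesgue_on {0..t}. g s)}"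

end

theory Submission
  imports Defs
begin

text \<open>
  For a fixed time scale \<open>\<tau>\<close> the two laws are those of \<open>w(\<tau> \<cdot>)\<close> and \<open>(w + h)(\<tau> \<cdot>)\<close>. If the energy
  of \<open>h\<close> is infinite, a matched filter separates them: pair the path with the increments of \<open>h\<close> over
  finer and finer dyadic grids and divide by the energy of \<open>h\<close> on the grid. The result tends to \<open>0\<close>
  for \<open>w\<close> and to \<open>1\<close> for \<open>w + h\<close>. Here, however, \<open>\<tau>\<close> is random, and a separating set must be a set of
  paths that works for almost all \<open>\<tau>\<close> at once; so \<open>\<tau>\<close> has to be read off the path. For \<open>w(\<tau> \<cdot>)\<close> it is
  the quadratic variation over the unit interval. For the shifted path this is still so if
  \<open>h(\<tau> \<cdot>)\<close> has vanishing quadratic variation along the dyadic grids, and the core of the proof is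
  to show that it has, for almost every \<open>\<tau>\<close> (\<open>shift_quadratic_variation\<close>).

  All steps use the same principle (\<open>X_law_transfer\<close>): a Borel property of paths that for
  every \<open>\<tau>\<close> is almost sure for \<open>w(\<tau> \<cdot>)\<close> is, by absolute continuity, almost sure for
  \<open>(w + h)(\<tau> \<cdot>)\<close> for almost every \<open>\<tau>\<close>. It is applied to three properties.

  First, the increments of a Brownian path over cells of length \<open>2^{-n}\<close> are eventually
  below \<open>(9/10)^n\<close>. So this holds for \<open>w\<close> and \<open>w + h\<close> on a common time scale, hence up to a
  factor for \<open>h\<close>, which is therefore Hoelder continuous (\<open>shift_modulus_of_continuity\<close>).

  Second, consider all candidates \<open>\<tau>'\<close> in a net of mesh \<open>16^{-n}\<close> for which the level \<open>n\<close> quadratic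
  variation of \<open>h(\<tau>' \<cdot>)\<close> is at least \<open>\<delta>\<close>. The probability that a Brownian path correlates strongly
  with one given \<open>h(\<tau>' \<cdot>)\<close> at level \<open>n\<close> is at most \<open>exp (- c \<delta> 2^n)\<close>, which beats the number of candidates:
  almost surely no candidate is detected for large \<open>n\<close>. But in a shifted path with time scale \<open>\<tau>\<close>
  the candidate next to \<open>\<tau>\<close> is detected, because by Hoelder continuity it differs little from
  \<open>h(\<tau> \<cdot>)\<close>. So the quadratic variation of \<open>h(\<tau> \<cdot>)\<close> tends to \<open>0\<close>.

  Third, the clock now being reliable on both sides, the matched filter at the time scale shown
  by the clock forces the dyadic energies of \<open>h\<close> to be bounded (\<open>shift_energy_bounded\<close>). The
  difference quotients of \<open>h\<close> on the dyadic grids are then a Cauchy sequence in \<open>L\<^sup>2\<close>,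
  and its limit is the derivative of \<open>h\<close> (\<open>cameron_martin_of_bounded_energy\<close>).
\<close>

section \<open>Path space and its evaluations\<close>

definition dyadic_floor :: "nat \<Rightarrow> real \<Rightarrow> real" where
  "dyadic_floor j t = of_int \<lfloor>2 ^ j * t\<rfloor> / 2 ^ j"

lemma dyadic_floor_le: "dyadic_floor j t \<le> t"
proof -
  have "of_int \<lfloor>2 ^ j * t\<rfloor> \<le> 2 ^ j * t" by (rule of_int_floor_le)
  then show ?thesis by (simp add: dyadic_floor_def divide_le_eq mult.commute)
qed

lemma dyadic_floor_gt: "t - 1 / 2 ^ j < dyadic_floor j t"
proof -
  have "2 ^ j * t - 1 < of_int \<lfloor>2 ^ j * t\<rfloor>" by linarith
  then have "(2 ^ j * t - 1) / 2 ^ j < of_int \<lfloor>2 ^ j * t\<rfloor> / 2 ^ j"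
    by (intro divide_strict_right_mono) auto
  then show ?thesis by (simp add: dyadic_floor_def diff_divide_distrib)
qed

lemma dyadic_floor_nonneg: "0 \<le> t \<Longrightarrow> 0 \<le> dyadic_floor j t"
  by (simp add: dyadic_floor_def)

lemma dyadic_floor_eq_nat: "0 \<le> t \<Longrightarrow> dyadic_floor j t = real (nat \<lfloor>2 ^ j * t\<rfloor>) / 2 ^ j"
  by (simp add: dyadic_floor_def)

lemma dyadic_floor_tendsto: "(\<lambda>j. dyadic_floor j t) \<longlonglongrightarrow> t"
proof (rule tendsto_sandwich[where f="\<lambda>j. t - 1 / 2 ^ j" and h="\<lambda>j. t"])
  show "(\<lambda>j. t - 1 / 2 ^ j) \<longlonglongrightarrow> t"
    using tendsto_diff[OF tendsto_const[of t] LIMSEQ_realpow_zero[of "1/2::real"]]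
    by (simp add: power_one_over)
qed (auto intro!: always_eventually dyadic_floor_le less_imp_le[OF dyadic_floor_gt])

lemma open_paths_subset: "{U. openin path_topology U} \<subseteq> Pow path_space"
  by (auto simp: openin_path_topology)

lemma space_path_borel: "space path_borel = path_space"
  unfolding path_borel_def using open_paths_subset by (rule space_measure_of)

lemma open_in_path_borel: "openin path_topology U \<Longrightarrow> U \<in> sets path_borel"
  unfolding path_borel_def using open_paths_subset by (simp add: sets_measure_of sigma_sets.Basic)

lemma measurable_eval_path: "(\<lambda>w. w s) \<in> borel_measurable path_borel"
proof (cases "0 \<le> s")
  case True
  have "{w \<in> path_space. a < w s} \<in> sets path_borel" for a
  proof (rule open_in_path_borel, unfold openin_path_topology, intro conjI ballI)
    fix w assume "w \<in> {w \<in> path_space. a < w s}"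
    then show "\<exists>T. \<exists>e>0. \<forall>v\<in>path_space.
        (\<forall>t\<in>{0..T}. \<bar>v t - w t\<bar> < e) \<longrightarrow> v \<in> {w \<in> path_space. a < w s}"
      using True by (intro exI[of _ s] exI[of _ "w s - a"]) force
  qed auto
  then show ?thesis
    by (simp add: borel_measurable_iff_greater space_path_borel)
next
  case False
  then have "w s = undefined" if "w \<in> space path_borel" for w
    using that by (auto simp: space_path_borel path_space_def extensional_def)
  then show ?thesis by (subst measurable_cong[where g="\<lambda>_. undefined"]) auto
qed

lemma path_continuous: "w \<in> path_space \<Longrightarrow> continuous_on {0..} w"
  by (simp add: path_space_def)

lemma path_tendsto:
  assumes "w \<in> path_space" "u \<longlonglongrightarrow> s" "\<And>n. 0 \<le> u n"
  shows "(\<lambda>n. w (u n)) \<longlonglongrightarrow> w s"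
proof -
  have "0 \<le> s" using assms(2,3) by (intro LIMSEQ_le_const) auto
  then show ?thesis
    by (intro continuous_on_tendsto_compose[OF path_continuous[OF assms(1)] assms(2)])
       (use assms(3) in auto)
qed

text \<open>Rounding the time down to a dyadic number leaves countably many evaluations to combine, and by
  continuity of the path the rounded values converge.\<close>

lemma measurable_eval_at_time:
  assumes [measurable]: "X \<in> measurable M path_borel" "T \<in> borel_measurable M"
    and T: "\<And>m. m \<in> space M \<Longrightarrow> 0 \<le> T m"
  shows "(\<lambda>m. X m (T m)) \<in> borel_measurable M"
proof (rule borel_measurable_LIMSEQ_real)
  fix m assume m: "m \<in> space M"
  then have "X m \<in> path_space"
    using measurable_space[OF assms(1)] by (simp add: space_path_borel)
  then show "(\<lambda>j. X m (dyadic_floor j (T m))) \<longlonglongrightarrow> X m (T m)"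
    by (rule path_tendsto[OF _ dyadic_floor_tendsto]) (intro dyadic_floor_nonneg T m)
next
  fix j
  have ev: "(\<lambda>m. X m (of_int i / 2 ^ j)) \<in> borel_measurable M" for i :: int
    by (rule measurable_compose[OF assms(1) measurable_eval_path])
  have "(\<lambda>m. \<lfloor>2 ^ j * T m\<rfloor>) \<in> measurable M (count_space UNIV)" by measurable
  then show "(\<lambda>m. X m (dyadic_floor j (T m))) \<in> borel_measurable M"
    unfolding dyadic_floor_def
    by (rule measurable_compose_countable[OF ev])
qed

text \<open>On the \<open>k\<close>-th cell of the grid of mesh \<open>1/m\<close> in \<open>{0..n}\<close> the path stays within \<open>1/p\<close> of the rational
  \<open>q ! k\<close>. Clamping the dyadic numbers to the cell yields a countable dense set of times there, so
  the condition involves countably many evaluations only; \<open>path_cellD\<close> recovers all times.\<close>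

definition path_cell :: "nat \<times> nat \<times> nat \<times> rat list \<Rightarrow> (real \<Rightarrow> real) set" where
  "path_cell = (\<lambda>(n, m, p, q). {v \<in> path_space. \<forall>k<n * m. \<forall>i j::nat.
     \<bar>v (max (real k / real m) (min (real (Suc k) / real m) (real i / 2 ^ j))) - real_of_rat (q ! k)\<bar>
       \<le> 1 / real p})"

lemma path_cellD:
  assumes v: "v \<in> path_cell (n, m, p, q)" and k: "k < n * m"
    and t: "real k / real m \<le> t" "t \<le> real (Suc k) / real m"
  shows "\<bar>v t - real_of_rat (q ! k)\<bar> \<le> 1 / real p"
proof -
  let ?a = "real k / real m" and ?b = "real (Suc k) / real m"
  have a0: "0 \<le> ?a" by simp
  then have t0: "0 \<le> t" using t(1) by linarith
  have vp: "v \<in> path_space" using v by (simp add: path_cell_def)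
  have "(\<lambda>j. max ?a (min ?b (dyadic_floor j t))) \<longlonglongrightarrow> max ?a (min ?b t)"
    by (intro tendsto_max tendsto_min tendsto_const dyadic_floor_tendsto)
  then have "(\<lambda>j. max ?a (min ?b (dyadic_floor j t))) \<longlonglongrightarrow> t" using t by simp
  then have "(\<lambda>j. v (max ?a (min ?b (dyadic_floor j t)))) \<longlonglongrightarrow> v t"
    by (intro path_tendsto[OF vp]) (use a0 in \<open>auto simp: le_max_iff_disj\<close>)
  then have "(\<lambda>j. \<bar>v (max ?a (min ?b (dyadic_floor j t))) - real_of_rat (q ! k)\<bar>)
      \<longlonglongrightarrow> \<bar>v t - real_of_rat (q ! k)\<bar>"
    by (intro tendsto_intros)
  then show ?thesis
  proof (rule LIMSEQ_le_const2)
    show "\<exists>N. \<forall>j\<ge>N. \<bar>v (max ?a (min ?b (dyadic_floor j t))) - real_of_rat (q ! k)\<bar> \<le> 1 / real p"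
      using v k by (auto simp: path_cell_def dyadic_floor_eq_nat[OF t0])
  qed
qed

text \<open>A path is uniformly continuous on \<open>{0..n}\<close>, so it lies in a cell whose members are all uniformly
  close to it there. As there are countably many cells, an open set is a countable union of cells.\<close>

lemma open_contains_cell:
  assumes U: "openin path_topology U" and w: "w \<in> U"
  obtains c where "w \<in> path_cell c" "path_cell c \<subseteq> U"
proof -
  obtain T e where e: "e > 0"
    and Te: "\<And>v. v \<in> path_space \<Longrightarrow> \<forall>t\<in>{0..T}. \<bar>v t - w t\<bar> < e \<Longrightarrow> v \<in> U"
    using U w unfolding openin_path_topology by blast
  have wp: "w \<in> path_space" using U w by (auto simp: openin_path_topology)
  obtain p :: nat where pe: "2 / e < real p" using reals_Archimedean2 by blast
  have "0 < 2 / e" using e by simp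
  then have p0: "0 < real p" using pe by linarith
  have p: "p > 0" "2 / real p < e"
    using pe p0 e by (simp_all add: divide_less_eq mult.commute)
  obtain n :: nat where n: "T < real n" using reals_Archimedean2 by blast
  have "uniformly_continuous_on {0..real n} w"
    by (intro compact_uniformly_continuous continuous_on_subset[OF path_continuous[OF wp]]) auto
  then have "\<exists>d>0. \<forall>t\<in>{0..real n}. \<forall>s\<in>{0..real n}. \<bar>s - t\<bar> < d \<longrightarrow> \<bar>w s - w t\<bar> < 1 / (2 * real p)"
    unfolding uniformly_continuous_on_def dist_real_def using p0 by simp
  then obtain d where d: "d > 0"
    "\<And>s t. s \<in> {0..real n} \<Longrightarrow> t \<in> {0..real n} \<Longrightarrow> \<bar>s - t\<bar> < d \<Longrightarrow> \<bar>w s - w t\<bar> < 1 / (2 * real p)"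
    by blast
  obtain m' :: nat where m': "1 / real (Suc m') < d"
    using reals_Archimedean[OF d(1)] by (auto simp: inverse_eq_divide)
  define m where "m = Suc m'"
  have m: "m > 0" "1 / real m < d" using m' by (simp_all add: m_def)
  have "\<exists>q::rat. \<bar>w (real k / real m) - real_of_rat q\<bar> < 1 / (2 * real p)" for k
  proof -
    have "w (real k / real m) < w (real k / real m) + 1 / (2 * real p)" using p(1) by simp
    from of_rat_dense[OF this] obtain q where
      "w (real k / real m) < real_of_rat q" "real_of_rat q < w (real k / real m) + 1 / (2 * real p)"
      by blast
    then show ?thesis by (intro exI[of _ q]) (simp add: abs_real_def)
  qed
  then obtain q where q: "\<And>k. \<bar>w (real k / real m) - real_of_rat (q k)\<bar> < 1 / (2 * real p)"
    by metis
  let ?c = "(n, m, p, map q [0..<n * m])"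
  \<comment> \<open>Uniform continuity and the rational approximation each use up half of the tolerance.\<close>
  have near: "\<bar>w (max (real k / real m) (min (real (Suc k) / real m) u)) - real_of_rat (q k)\<bar> \<le> 1 / real p"
    if k: "k < n * m" for k u
  proof -
    define a where "a = real k / real m"
    define b where "b = real (Suc k) / real m"
    define t where "t = max a (min b u)"
    have ab: "a \<le> b" "b - a = 1 / real m"
      by (simp_all add: a_def b_def divide_right_mono diff_divide_distrib[symmetric])
    have "real (Suc k) \<le> real n * real m" using k by (metis Suc_leI of_nat_le_iff of_nat_mult)
    then have bn: "b \<le> real n" using m(1) by (simp add: b_def pos_divide_le_eq)
    have a0: "0 \<le> a" by (simp add: a_def)
    have tab: "a \<le> t" "t \<le> b" using ab(1) by (auto simp: t_def)
    have "\<bar>w t - w a\<bar> < 1 / (2 * real p)"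
      by (rule d(2)) (use tab ab a0 bn m(2) in auto)
    moreover have "\<bar>w a - real_of_rat (q k)\<bar> < 1 / (2 * real p)"
      using q[of k] by (simp add: a_def)
    moreover have "1 / real p = 1 / (2 * real p) + 1 / (2 * real p)"
      using p0 by (simp add: field_simps)
    ultimately show ?thesis unfolding t_def a_def b_def by linarith
  qed
  have wc: "w \<in> path_cell ?c"
    unfolding path_cell_def using wp near by (simp del: of_nat_Suc)
  have "path_cell ?c \<subseteq> U"
  proof
    fix v assume v: "v \<in> path_cell ?c"
    have "\<bar>v t - w t\<bar> < e" if t: "t \<in> {0..T}" for t
    proof -
      define k where "k = nat \<lfloor>t * real m\<rfloor>"
      have "0 \<le> t * real m" using t by simp
      then have k1: "real k \<le> t * real m" "t * real m < real k + 1"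
        unfolding k_def by linarith+
      have "t * real m < real n * real m" using t n m(1) by simp
      then have "real k < real (n * m)" using k1 by simp
      then have kn: "k < n * m" by linarith
      have tk: "real k / real m \<le> t" "t \<le> real (Suc k) / real m"
        using k1 m(1) by (simp_all add: pos_divide_le_eq pos_le_divide_eq)
      have "\<bar>v t - real_of_rat (q k)\<bar> \<le> 1 / real p" "\<bar>w t - real_of_rat (q k)\<bar> \<le> 1 / real p"
        using path_cellD[OF v kn tk] path_cellD[OF wc kn tk] kn by simp_all
      then have "\<bar>v t - w t\<bar> \<le> 2 / real p" by linarith
      then show ?thesis using p(2) by linarith
    qed
    then show "v \<in> U" using v by (intro Te) (auto simp: path_cell_def)
  qed
  with wc show ?thesis by (rule that)
qed

text \<open>The evaluations generate the Borel sets: cells are defined by countably many evaluations, and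
  open sets are countable unions of cells.\<close>

lemma measurable_path_borelI:
  assumes sp: "\<And>m. m \<in> space M \<Longrightarrow> X m \<in> path_space"
    and ev [measurable]: "\<And>s. 0 \<le> s \<Longrightarrow> (\<lambda>m. X m s) \<in> borel_measurable M"
  shows "X \<in> measurable M path_borel"
  unfolding path_borel_def
proof (rule measurable_measure_of[OF open_paths_subset])
  show "X \<in> space M \<rightarrow> path_space" using sp by auto
next
  fix U assume "U \<in> {U. openin path_topology U}"
  then have U: "openin path_topology U" by simp
  have cell: "X -` path_cell c \<inter> space M \<in> sets M" for c
  proof -
    obtain n m p q where c: "c = (n, m, p, q)" by (cases c)
    have "X -` path_cell c \<inter> space M = {x \<in> space M. \<forall>k<n * m. \<forall>i j::nat.
        \<bar>X x (max (real k / real m) (min (real (Suc k) / real m) (real i / 2 ^ j)))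
          - real_of_rat (q ! k)\<bar> \<le> 1 / real p}"
      using sp by (auto simp: c path_cell_def)
    also have "\<dots> \<in> sets M"
    proof -
      have [measurable]: "(\<lambda>x. X x (max (real k / real m) (min (real (Suc k) / real m) (real i / 2 ^ j))))
        \<in> borel_measurable M" for k i j :: nat
        by (rule ev) (simp add: le_max_iff_disj)
      show ?thesis by measurable
    qed
    finally show ?thesis .
  qed
  have "X -` U \<inter> space M = (\<Union>c\<in>{c. path_cell c \<subseteq> U}. X -` path_cell c \<inter> space M)"
  proof (intro equalityI subsetI)
    fix x assume x: "x \<in> X -` U \<inter> space M"
    then obtain c where "X x \<in> path_cell c" "path_cell c \<subseteq> U"
      using open_contains_cell[OF U, of "X x"] by blast
    with x show "x \<in> (\<Union>c\<in>{c. path_cell c \<subseteq> U}. X -` path_cell c \<inter> space M)" by blast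
  qed blast
  also have "\<dots> \<in> sets M" 
    by (rule sets.countable_UN'[OF countableI_type]) (use cell in blast)
  finally show "X -` U \<inter> space M \<in> sets M" .
qed

section \<open>Random change of time\<close>

lemma mittag_leffler_0: "mittag_leffler \<beta> 0 = 1"
proof -
  have "mittag_leffler \<beta> 0 = (\<Sum>n. (1 / Gamma (\<beta> * real n + 1)) * 0 ^ n)"
    unfolding mittag_leffler_def by simp
  also have "\<dots> = 1" by (subst powser_zero) simp
  finally show ?thesis .
qed

text \<open>The Laplace transform at \<open>0\<close> is the total mass, and a law with a density does not charge \<open>0\<close>.\<close>

lemma Y_law_properties:
  assumes "Y_law \<beta> Q"
  shows "prob_space Q" and "sets Q = sets (restrict_space borel {0..})" and "AE \<tau> in Q. 0 < \<tau>"
proof -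
  let ?L = "restrict_space lborel {0::real..}"
  obtain M where M [measurable]: "M \<in> borel_measurable ?L" and M0: "\<And>\<tau>. 0 \<le> \<tau> \<Longrightarrow> 0 \<le> M \<tau>"
    and lap: "\<And>s. 0 \<le> s \<Longrightarrow> has_bochner_integral ?L (\<lambda>\<tau>. exp (- (s * \<tau>)) * M \<tau>) (mittag_leffler \<beta> (- s))"
    and Q: "Q = density ?L (\<lambda>\<tau>. ennreal (M \<tau>))"
    using assms unfolding Y_law_def by blast
  have sp: "space ?L = {0..}" by (simp add: space_restrict_space)
  have AE_M0: "AE \<tau> in ?L. 0 \<le> M \<tau>" by (rule AE_I2) (simp add: sp M0)
  have "has_bochner_integral ?L M 1" using lap[of 0] by (simp add: mittag_leffler_0)
  then have "(\<integral>\<^sup>+\<tau>. ennreal (M \<tau>) \<partial>?L) = 1"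
    by (subst nn_integral_eq_integral) (simp_all add: has_bochner_integral_iff AE_M0)
  moreover have "emeasure Q (space Q) = (\<integral>\<^sup>+\<tau>. 1 \<partial>Q)"
    by simp
  moreover have "\<dots> = (\<integral>\<^sup>+\<tau>. ennreal (M \<tau>) \<partial>?L)"
    unfolding Q by (subst nn_integral_density) (auto intro: measurable_ennreal)
  ultimately have "emeasure Q (space Q) = 1" by metis
  then show "prob_space Q" by (rule prob_spaceI)
  show "sets Q = sets (restrict_space borel {0..})"
    unfolding Q by (simp add: sets_restrict_space)
  have "AE \<tau> in lborel. \<tau> \<noteq> (0::real)" by (rule AE_lborel_singleton)
  then have "AE \<tau> in ?L. 0 < \<tau>"
    by (subst AE_restrict_space_iff) auto
  then show "AE \<tau> in Q. 0 < \<tau>"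
    unfolding Q by (subst AE_density) auto
qed

definition dilate :: "real \<Rightarrow> (real \<Rightarrow> real) \<Rightarrow> real \<Rightarrow> real" where
  "dilate \<tau> w = (\<lambda>t\<in>{0..}. w (t * \<tau>))"

lemma dilate_apply: "0 \<le> t \<Longrightarrow> dilate \<tau> w t = w (t * \<tau>)"
  by (simp add: dilate_def)

lemma dilate_in_path_space:
  assumes "continuous_on {0..} w" "w 0 = 0" "0 \<le> \<tau>"
  shows "dilate \<tau> w \<in> path_space"
proof -
  have "continuous_on {0..} (\<lambda>t. w (t * \<tau>))"
    by (rule continuous_on_compose2[OF assms(1)]) (use assms(3) in \<open>auto intro!: continuous_intros\<close>)
  then have "continuous_on {0..} (dilate \<tau> w)"
    by (rule continuous_on_eq) (simp add: dilate_apply)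
  then show ?thesis using assms(2) by (simp add: path_space_def dilate_def)
qed

text \<open>By Fubini, the hypothesis says that \<open>A\<close> holds almost surely under \<^const>\<open>X_law\<close>; absolute continuity
  carries this over to \<^const>\<open>X_shifted_law\<close>, and Fubini again gives the conclusion. That both path
  maps are measurable, which makes the two laws genuine image measures, is checked on evaluations.\<close>

lemma X_law_transfer:
  assumes P: "wiener_measure P" and Q: "prob_space Q" "sets Q = sets (restrict_space borel {0..})"
    and h: "h \<in> path_space"
    and ac: "absolutely_continuous (X_law P Q) (X_shifted_law P Q h)"
    and A: "Measurable.pred path_borel A"
    and AE: "AE \<tau> in Q. AE w in P. A (dilate \<tau> w)"
  shows "AE \<tau> in Q. AE w in P. A (dilate \<tau> (\<lambda>t. w t + h t))"
proof -
  interpret P: prob_space P using P by (simp add: wiener_measure_def)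
  interpret Q: prob_space Q by (rule Q)
  interpret pair_sigma_finite P Q by unfold_locales
  have sP: "sets P = sets path_borel" using P by (simp add: wiener_measure_def)
  then have spP: "space P = path_space" using sets_eq_imp_space_eq space_path_borel by metis
  have spQ: "space Q = {0..}" using sets_eq_imp_space_eq[OF Q(2)] by (simp add: space_restrict_space)
  have fst_m: "fst \<in> measurable (P \<Otimes>\<^sub>M Q) path_borel"
    using measurable_fst[of P Q] measurable_cong_sets[OF refl sP] by blast
  have "id \<in> measurable (restrict_space borel {0::real..}) borel"
    by (intro measurable_restrict_space1) (simp add: measurable_ident)
  then have "(\<lambda>x. x) \<in> borel_measurable Q"
    using measurable_cong_sets[OF Q(2) refl] by (auto simp: id_def)
  from measurable_compose[OF measurable_snd this]
  have snd_m [measurable]: "snd \<in> borel_measurable (P \<Otimes>\<^sub>M Q)" .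
  have sp: "fst x \<in> path_space" "0 \<le> snd x" if "x \<in> space (P \<Otimes>\<^sub>M Q)" for x
    using that by (auto simp: space_pair_measure spP spQ)
  have ev: "(\<lambda>x. fst x (s * snd x)) \<in> borel_measurable (P \<Otimes>\<^sub>M Q)" if "0 \<le> s" for s
    by (rule measurable_eval_at_time[OF fst_m]) (use that sp in auto)
  have hev: "(\<lambda>x. h (s * snd x)) \<in> borel_measurable (P \<Otimes>\<^sub>M Q)" if "0 \<le> s" for s
    by (rule measurable_eval_at_time[of "\<lambda>_. h"])
      (use that sp h in \<open>auto simp: space_path_borel\<close>)
  have X: "X_path x = dilate (snd x) (fst x)"
    "X_shifted_path h x = dilate (snd x) (\<lambda>t. fst x t + h t)" for x
    by (cases x; simp add: X_path_def X_shifted_path_def dilate_def)+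
  have m1: "X_path \<in> measurable (P \<Otimes>\<^sub>M Q) path_borel"
  proof (rule measurable_path_borelI)
    show "X_path x \<in> path_space" if "x \<in> space (P \<Otimes>\<^sub>M Q)" for x
      using sp[OF that] unfolding X path_space_def
      by (intro dilate_in_path_space[unfolded path_space_def]) auto
    show "(\<lambda>x. X_path x s) \<in> borel_measurable (P \<Otimes>\<^sub>M Q)" if "0 \<le> s" for s
      using ev[OF that] by (simp add: X dilate_apply[OF that])
  qed
  have m2: "X_shifted_path h \<in> measurable (P \<Otimes>\<^sub>M Q) path_borel"
  proof (rule measurable_path_borelI)
    show "X_shifted_path h x \<in> path_space" if "x \<in> space (P \<Otimes>\<^sub>M Q)" for x
      using sp[OF that] h unfolding X path_space_def
      by (intro dilate_in_path_space[unfolded path_space_def]) (auto intro!: continuous_intros)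
    show "(\<lambda>x. X_shifted_path h x s) \<in> borel_measurable (P \<Otimes>\<^sub>M Q)" if "0 \<le> s" for s
      using ev[OF that] hev[OF that] by (simp add: X dilate_apply[OF that])
  qed
  note A1 = measurable_compose[OF m1 A] and A2 = measurable_compose[OF m2 A]
  have "AE w in P. AE \<tau> in Q. A (X_path (w, \<tau>))"
    using AE A1 by (subst AE_commute) (simp_all add: X pred_def split_beta')
  then have "AE x in P \<Otimes>\<^sub>M Q. A (X_path x)"
    using A1 by (subst (asm) AE_pair_iff) (simp_all add: pred_def)
  then have "AE x in X_law P Q. A x"
    unfolding X_law_def using A m1 by (subst AE_distr_iff) (auto simp: pred_def)
  then have "AE x in X_shifted_law P Q h. A x"
    by (intro absolutely_continuous_AE[OF _ ac]) (simp_all add: X_law_def X_shifted_law_def)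
  then have "AE x in P \<Otimes>\<^sub>M Q. A (X_shifted_path h x)"
    unfolding X_shifted_law_def using A m2 by (subst (asm) AE_distr_iff) (auto simp: pred_def)
  then have "AE w in P. AE \<tau> in Q. A (X_shifted_path h (w, \<tau>))"
    using A2 by (subst AE_pair_iff) (simp_all add: pred_def)
  then show ?thesis
    using A2 by (subst (asm) AE_commute) (simp_all add: X pred_def split_beta')
qed

section \<open>Moments of independent Gaussian increments\<close>

text \<open>The sum of the integrals is the integral of the sum, so the sum is finite almost everywhere.
  All almost sure statements about Brownian paths below are derived from moment bounds in this way.\<close>

lemma AE_summable_of_summable_integrals:
  fixes f :: "nat \<Rightarrow> 'a \<Rightarrow> real"
  assumes f: "\<And>n. integrable M (f n)" "\<And>n x. 0 \<le> f n x"
    and c: "\<And>n. integral\<^sup>L M (f n) \<le> c n" "summable c"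
  shows "AE x in M. summable (\<lambda>n. f n x)"
proof -
  have [measurable]: "f n \<in> borel_measurable M" for n using f(1) by auto
  have c0: "0 \<le> c n" for n
    using order_trans[OF Bochner_Integration.integral_nonneg c(1)] f(2) by blast
  have "(\<integral>\<^sup>+x. (\<Sum>n. ennreal (f n x)) \<partial>M) = (\<Sum>n. \<integral>\<^sup>+x. ennreal (f n x) \<partial>M)"
    by (rule nn_integral_suminf) measurable
  also have "\<dots> = (\<Sum>n. ennreal (integral\<^sup>L M (f n)))"
    using f by (simp add: nn_integral_eq_integral)
  also have "\<dots> \<le> (\<Sum>n. ennreal (c n))"
    by (intro suminf_le ennreal_leI c) auto
  also have "\<dots> = ennreal (\<Sum>n. c n)"
    using c0 c(2) by (rule suminf_ennreal2)
  also have "\<dots> < \<infinity>" by simp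
  finally have "AE x in M. (\<Sum>n. ennreal (f n x)) \<noteq> \<infinity>"
    by (intro nn_integral_PInf_AE) auto
  then show ?thesis
  proof (rule AE_mp, intro AE_I2 impI)
    fix x assume "(\<Sum>n. ennreal (f n x)) \<noteq> \<infinity>"
    then show "summable (\<lambda>n. f n x)"
      using f(2) by (intro summable_suminf_not_top) auto
  qed
qed

lemma AE_tendsto_zero_of_summable_integrals:
  fixes f :: "nat \<Rightarrow> 'a \<Rightarrow> real"
  assumes "\<And>n. integrable M (f n)" "\<And>n x. 0 \<le> f n x"
    and "\<And>n. integral\<^sup>L M (f n) \<le> c n" "summable c"
  shows "AE x in M. (\<lambda>n. f n x) \<longlonglongrightarrow> 0"
  using AE_summable_of_summable_integrals[OF assms] by eventually_elim (rule summable_LIMSEQ_zero)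

text \<open>Independence kills the mixed terms. The lemma serves twice: for Gaussian increments and for their
  centred squares, whose sum is the deviation of the quadratic variation from its mean.\<close>

lemma (in prob_space) second_moment_weighted_sum:
  fixes Z :: "'b \<Rightarrow> 'a \<Rightarrow> real"
  assumes ind: "indep_vars (\<lambda>_. borel) Z I" and fin: "finite I"
    and Z: "\<And>i. i \<in> I \<Longrightarrow> expectation (Z i) = 0"
      "\<And>i. i \<in> I \<Longrightarrow> integrable M (\<lambda>x. (Z i x)\<^sup>2)"
      "\<And>i. i \<in> I \<Longrightarrow> expectation (\<lambda>x. (Z i x)\<^sup>2) = v"
  shows "integrable M (\<lambda>x. (\<Sum>i\<in>I. a i * Z i x)\<^sup>2)"
    and "expectation (\<lambda>x. (\<Sum>i\<in>I. a i * Z i x)\<^sup>2) = v * (\<Sum>i\<in>I. (a i)\<^sup>2)"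
proof -
  have rv: "random_variable borel (Z i)" if "i \<in> I" for i
    using ind that unfolding indep_vars_def by blast
  have int1: "integrable M (Z i)" if "i \<in> I" for i
    using square_integrable_imp_integrable[OF rv[OF that]] Z(2)[OF that] by simp
  have prod: "integrable M (\<lambda>x. Z i x * Z j x) \<and> expectation (\<lambda>x. Z i x * Z j x) = (if i = j then v else 0)"
    if ij: "i \<in> I" "j \<in> I" for i j
  proof (cases "i = j")
    case True
    then show ?thesis using Z(2,3) ij by (simp add: power2_eq_square)
  next
    case False
    have "indep_vars (\<lambda>_. borel) Z {i, j}" by (rule indep_vars_subset[OF ind]) (use ij in auto)
    then have "integrable M (\<lambda>x. \<Prod>k\<in>{i, j}. Z k x)"
      "expectation (\<lambda>x. \<Prod>k\<in>{i, j}. Z k x) = (\<Prod>k\<in>{i, j}. expectation (Z k))"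
      using int1 ij by (auto intro!: indep_vars_integrable indep_vars_lebesgue_integral)
    then show ?thesis using False Z(1)[OF ij(1)] by simp
  qed
  have sq: "(\<Sum>i\<in>I. a i * Z i x)\<^sup>2 = (\<Sum>i\<in>I. \<Sum>j\<in>I. a i * a j * (Z i x * Z j x))" for x
    by (simp add: power2_eq_square sum_product mult_ac)
  show "integrable M (\<lambda>x. (\<Sum>i\<in>I. a i * Z i x)\<^sup>2)"
    unfolding sq using prod by (intro Bochner_Integration.integrable_sum integrable_mult_right) auto
  have "expectation (\<lambda>x. (\<Sum>i\<in>I. a i * Z i x)\<^sup>2)
      = (\<Sum>i\<in>I. \<Sum>j\<in>I. a i * a j * expectation (\<lambda>x. Z i x * Z j x))"
    unfolding sq using prod by (simp add: Bochner_Integration.integral_sum)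
  also have "\<dots> = (\<Sum>i\<in>I. \<Sum>j\<in>I. if i = j then v * (a i)\<^sup>2 else 0)"
    using prod by (intro sum.cong refl) (simp add: power2_eq_square)
  also have "\<dots> = v * (\<Sum>i\<in>I. (a i)\<^sup>2)"
    using fin by (simp add: sum_distrib_left)
  finally show "expectation (\<lambda>x. (\<Sum>i\<in>I. a i * Z i x)\<^sup>2) = v * (\<Sum>i\<in>I. (a i)\<^sup>2)" .
qed

text \<open>Completing the square turns the exponential factor into a shift of the mean of the density.\<close>

lemma normal_exp_moment:
  assumes "0 < \<sigma>"
  shows "has_bochner_integral lborel (\<lambda>x. normal_density 0 \<sigma> x * exp (c * x)) (exp (c\<^sup>2 * \<sigma>\<^sup>2 / 2))"
proof -
  have "normal_density 0 \<sigma> x * exp (c * x) = exp (c\<^sup>2 * \<sigma>\<^sup>2 / 2) * normal_density (c * \<sigma>\<^sup>2) \<sigma> x" for x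
  proof -
    have "- (x - 0)\<^sup>2 / (2 * \<sigma>\<^sup>2) + c * x = c\<^sup>2 * \<sigma>\<^sup>2 / 2 + - (x - c * \<sigma>\<^sup>2)\<^sup>2 / (2 * \<sigma>\<^sup>2)"
      using assms by (simp add: field_simps power2_eq_square)
    then show ?thesis
      unfolding normal_density_def by (simp add: exp_add[symmetric])
  qed
  moreover have "has_bochner_integral lborel (\<lambda>x. exp (c\<^sup>2 * \<sigma>\<^sup>2 / 2) * normal_density (c * \<sigma>\<^sup>2) \<sigma> x)
      (exp (c\<^sup>2 * \<sigma>\<^sup>2 / 2) * 1)"
    using assms by (intro has_bochner_integral_mult_right) (simp add: has_bochner_integral_iff)
  ultimately show ?thesis by simp
qed

context prob_space
begin

lemma centred_normal_moments:
  assumes D: "distributed M lborel D (\<lambda>x. ennreal (normal_density 0 (sqrt s) x))" and s: "0 < s"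
  shows "expectation D = 0"
    and "integrable M (\<lambda>x. (D x)\<^sup>2)" "expectation (\<lambda>x. (D x)\<^sup>2) = s"
    and "integrable M (\<lambda>x. (D x) ^ 4)" "expectation (\<lambda>x. (D x) ^ 4) = 3 * s\<^sup>2"
    and "integrable M (\<lambda>x. exp (c * D x))" "expectation (\<lambda>x. exp (c * D x)) = exp (c\<^sup>2 * s / 2)"
proof -
  have *: "integrable M (\<lambda>x. g (D x)) \<and> expectation (\<lambda>x. g (D x)) = y"
    if "has_bochner_integral lborel (\<lambda>x. normal_density 0 (sqrt s) x * g x) y"
      and [measurable]: "g \<in> borel_measurable borel" for g y
    using that distributed_integrable[OF D, of g] distributed_integral[OF D, of g]
    by (simp add: has_bochner_integral_iff)
  have s': "0 < sqrt s" using s by simp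
  show "expectation D = 0"
    using *[of "\<lambda>x. x" 0] normal_moment_odd[OF s', of 0 0] by simp
  show "integrable M (\<lambda>x. (D x)\<^sup>2)" "expectation (\<lambda>x. (D x)\<^sup>2) = s"
    using *[of "\<lambda>x. x\<^sup>2" s] normal_moment_even[OF s', of 0 1] s by simp_all
  have "fact 4 / ((2 / s)\<^sup>2 * 2) = 3 * s\<^sup>2"
    using s by (simp add: fact_numeral field_simps)
  then show "integrable M (\<lambda>x. (D x) ^ 4)" "expectation (\<lambda>x. (D x) ^ 4) = 3 * s\<^sup>2"
    using *[of "\<lambda>x. x ^ 4" "3 * s\<^sup>2"] normal_moment_even[OF s', of 0 2] s
    by simp_all
  show "integrable M (\<lambda>x. exp (c * D x))" "expectation (\<lambda>x. exp (c * D x)) = exp (c\<^sup>2 * s / 2)"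
    using *[of "\<lambda>x. exp (c * x)" "exp (c\<^sup>2 * s / 2)"] normal_exp_moment[OF s', of c] s by simp_all
qed

context
  fixes D :: "nat \<Rightarrow> 'a \<Rightarrow> real" and N :: nat and s :: real
  assumes ind: "indep_vars (\<lambda>_. borel) D {..<N}" and s: "0 < s"
    and D: "\<And>k. k < N \<Longrightarrow> distributed M lborel (D k) (\<lambda>x. ennreal (normal_density 0 (sqrt s) x))"
begin

lemma gaussian_linear_second_moment:
  "integrable M (\<lambda>x. (\<Sum>k<N. a k * D k x)\<^sup>2)"
  "expectation (\<lambda>x. (\<Sum>k<N. a k * D k x)\<^sup>2) = s * (\<Sum>k<N. (a k)\<^sup>2)"
  using second_moment_weighted_sum[OF ind, of s a] centred_normal_moments(1-3)[OF D s] by simp_all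

lemma gaussian_linear_exp_moment:
  "integrable M (\<lambda>x. exp (\<Sum>k<N. a k * D k x))"
  "expectation (\<lambda>x. exp (\<Sum>k<N. a k * D k x)) = exp (s * (\<Sum>k<N. (a k)\<^sup>2) / 2)"
proof -
  have ind': "indep_vars (\<lambda>_. borel) (\<lambda>k x. exp (a k * D k x)) {..<N}"
    by (rule indep_vars_compose2[OF ind, of "\<lambda>k y. exp (a k * y)"]) auto
  have e: "exp (\<Sum>k<N. a k * D k x) = (\<Prod>k<N. exp (a k * D k x))" for x
    by (rule exp_sum) simp
  show "integrable M (\<lambda>x. exp (\<Sum>k<N. a k * D k x))"
    unfolding e using centred_normal_moments(6)[OF D s]
    by (intro indep_vars_integrable[OF _ ind']) auto
  have "expectation (\<lambda>x. exp (\<Sum>k<N. a k * D k x)) = (\<Prod>k<N. expectation (\<lambda>x. exp (a k * D k x)))"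
    unfolding e using centred_normal_moments(6)[OF D s]
    by (intro indep_vars_lebesgue_integral[OF _ ind']) auto
  also have "\<dots> = (\<Prod>k<N. exp ((a k)\<^sup>2 * s / 2))"
    using centred_normal_moments(7)[OF D s] by simp
  also have "\<dots> = exp (s * (\<Sum>k<N. (a k)\<^sup>2) / 2)"
    by (simp add: exp_sum[symmetric] sum_distrib_left sum_divide_distrib mult.commute)
  finally show "expectation (\<lambda>x. exp (\<Sum>k<N. a k * D k x)) = exp (s * (\<Sum>k<N. (a k)\<^sup>2) / 2)" .
qed

lemma gaussian_quadratic_second_moment:
  "integrable M (\<lambda>x. ((\<Sum>k<N. (D k x)\<^sup>2) - N * s)\<^sup>2)"
  "expectation (\<lambda>x. ((\<Sum>k<N. (D k x)\<^sup>2) - N * s)\<^sup>2) = 2 * s\<^sup>2 * N"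
proof -
  let ?Z = "\<lambda>k x. (D k x)\<^sup>2 - s"
  have ind': "indep_vars (\<lambda>_. borel) ?Z {..<N}"
    by (rule indep_vars_compose2[OF ind, of "\<lambda>k y. y\<^sup>2 - s"]) auto
  have Z: "expectation (?Z k) = 0" "integrable M (\<lambda>x. (?Z k x)\<^sup>2)"
    "expectation (\<lambda>x. (?Z k x)\<^sup>2) = 2 * s\<^sup>2" if k: "k < N" for k
  proof -
    note m = centred_normal_moments(2-5)[OF D[OF k] s]
    have sq: "(?Z k x)\<^sup>2 = (D k x) ^ 4 - 2 * s * (D k x)\<^sup>2 + s\<^sup>2" for x
      by (simp add: power2_diff power_mult[symmetric])
    show "expectation (?Z k) = 0" using m by (simp add: prob_space)
    show "integrable M (\<lambda>x. (?Z k x)\<^sup>2)" unfolding sq using m by simp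
    show "expectation (\<lambda>x. (?Z k x)\<^sup>2) = 2 * s\<^sup>2" unfolding sq using m
      by (simp add: prob_space power2_eq_square)
  qed
  have e: "(\<Sum>k<N. (D k x)\<^sup>2) - N * s = (\<Sum>k<N. 1 * ?Z k x)" for x
    by (simp add: sum_subtractf)
  show "integrable M (\<lambda>x. ((\<Sum>k<N. (D k x)\<^sup>2) - N * s)\<^sup>2)"
    "expectation (\<lambda>x. ((\<Sum>k<N. (D k x)\<^sup>2) - N * s)\<^sup>2) = 2 * s\<^sup>2 * N"
    unfolding e using second_moment_weighted_sum[OF ind', of "2 * s\<^sup>2" "\<lambda>_. 1"] Z by simp_all
qed

lemma gaussian_fourth_moment:
  "integrable M (\<lambda>x. \<Sum>k<N. (D k x) ^ 4)"
  "expectation (\<lambda>x. \<Sum>k<N. (D k x) ^ 4) = 3 * s\<^sup>2 * N"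
  using centred_normal_moments(4,5)[OF D s] by (auto simp: Bochner_Integration.integral_sum)

end

end

definition increment :: "(real \<Rightarrow> real) \<Rightarrow> real \<Rightarrow> nat \<Rightarrow> real" where
  "increment x s k = x (real (Suc k) * s) - x (real k * s)"

lemma wiener_increments:
  assumes P: "wiener_measure P" and s: "0 < s"
  shows "prob_space.indep_vars P (\<lambda>_. borel) (\<lambda>k w. increment w s k) {..<N}"
    and "distributed P lborel (\<lambda>w. increment w s k) (\<lambda>x. ennreal (normal_density 0 (sqrt s) x))"
proof -
  have t: "real k * s < real (Suc k) * s" for k using s by simp
  show "prob_space.indep_vars P (\<lambda>_. borel) (\<lambda>k w. increment w s k) {..<N}"
    using P t unfolding wiener_measure_def increment_def
    by (elim conjE allE[of _ N] allE[of _ "\<lambda>k. real k * s"]) simp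
  have "real (Suc k) * s - real k * s = s" by (simp add: algebra_simps)
  then show "distributed P lborel (\<lambda>w. increment w s k) (\<lambda>x. ennreal (normal_density 0 (sqrt s) x))"
    using P t[of k] s unfolding wiener_measure_def increment_def
    by (elim conjE allE[of _ "real k * s"] allE[of _ "real (Suc k) * s"]) simp
qed

section \<open>Bounded dyadic energy implies finite energy\<close>

text \<open>The integral over \<open>{0..n}\<close> of the square of the derivative of the piecewise linear function that
  interpolates \<open>h\<close> on the grid of mesh \<open>1 / 2 ^ n\<close>; \<open>dyadic_slope\<close> is this derivative, extended by \<open>0\<close>.
  Letting the interval grow together with the level makes a single index exhaust the half-line.\<close>

definition dyadic_energy :: "(real \<Rightarrow> real) \<Rightarrow> nat \<Rightarrow> real" where
  "dyadic_energy h n = (\<Sum>k<n * 2 ^ n. 2 ^ n * (increment h (1 / 2 ^ n) k)\<^sup>2)"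

definition dyadic_slope :: "(real \<Rightarrow> real) \<Rightarrow> nat \<Rightarrow> real \<Rightarrow> real" where
  "dyadic_slope h n s = (\<Sum>k<n * 2 ^ n. 2 ^ n * increment h (1 / 2 ^ n) k *
     indicator {real k * (1 / 2 ^ n)..<real (Suc k) * (1 / 2 ^ n)} s)"

lemma dyadic_slope_measurable [measurable]: "dyadic_slope h n \<in> borel_measurable borel"
  unfolding dyadic_slope_def[abs_def] by measurable

lemma integrable_indicator_Ico: "integrable lborel (indicator {a..<b::real} :: real \<Rightarrow> real)"
  by (rule integrable_real_indicator) (cases "a \<le> b"; simp)+

lemma dyadic_slope_integrable: "integrable lborel (dyadic_slope h n)"
  unfolding dyadic_slope_def[abs_def]
  by (intro Bochner_Integration.integrable_sum integrable_mult_right integrable_indicator_Ico)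

text \<open>The integral of the slope telescopes, which recovers \<open>h\<close> at the grid points.\<close>

lemma dyadic_slope_initial_integral:
  assumes h0: "h 0 = 0" and j: "j \<le> n * 2 ^ n"
  shows "integral\<^sup>L lborel (\<lambda>s. dyadic_slope h n s * indicator {0..<real j * (1 / 2 ^ n)} s)
      = h (real j * (1 / 2 ^ n))"
proof -
  define e :: real where "e = 1 / 2 ^ n"
  define c where "c k = 2 ^ n * increment h e k" for k
  have e: "0 < e" by (simp add: e_def)
  have ce: "c k * e = increment h e k" for k by (simp add: c_def e_def)
  have "dyadic_slope h n s * indicator {0..<real j * e} s
      = (\<Sum>k<n * 2 ^ n. if k < j then c k * indicator {real k * e..<real (Suc k) * e} s else 0)" for s
    unfolding dyadic_slope_def e_def[symmetric] c_def[symmetric] sum_distrib_right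
  proof (intro sum.cong refl)
    fix k
    have 1: "s < real j * e" if "k < j" "s < real (Suc k) * e"
    proof -
      have "real (Suc k) * e \<le> real j * e" using that(1) e by (intro mult_right_mono) auto
      then show ?thesis using that(2) by linarith
    qed
    have 2: "real j * e \<le> real k * e" if "\<not> k < j" using that e by (intro mult_right_mono) auto
    have "0 \<le> real k * e" using e by simp
    then show "c k * indicator {real k * e..<real (Suc k) * e} s * indicator {0..<real j * e} s
        = (if k < j then c k * indicator {real k * e..<real (Suc k) * e} s else 0)"
      using 1 2 by (auto simp: indicator_def simp del: of_nat_Suc)
  qed
  then have "integral\<^sup>L lborel (\<lambda>s. dyadic_slope h n s * indicator {0..<real j * e} s)
      = integral\<^sup>L lborel (\<lambda>s. \<Sum>k<n * 2 ^ n. if k < j then c k * indicator {real k * e..<real (Suc k) * e} s else 0)"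
    by simp
  also have "\<dots> = (\<Sum>k<n * 2 ^ n. integral\<^sup>L lborel (\<lambda>s. if k < j then c k * indicator {real k * e..<real (Suc k) * e} s else 0))"
  proof (rule Bochner_Integration.integral_sum)
    fix k
    show "integrable lborel (\<lambda>s. if k < j then c k * indicator {real k * e..<real (Suc k) * e} s else 0)"
      by (cases "k < j") (simp_all add: integrable_indicator_Ico del: of_nat_Suc)
  qed
  also have "\<dots> = (\<Sum>k<n * 2 ^ n. if k < j then increment h e k else 0)"
  proof (intro sum.cong refl)
    fix k
    have "measure lborel {real k * e..<real (Suc k) * e} = e"
      using e by (simp add: algebra_simps)
    then show "integral\<^sup>L lborel (\<lambda>s. if k < j then c k * indicator {real k * e..<real (Suc k) * e} s else 0)
        = (if k < j then increment h e k else 0)"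
      using ce[of k] by simp
  qed
  also have "\<dots> = (\<Sum>k<j. increment h e k)"
    using j by (intro sum.mono_neutral_cong_right) auto
  also have "\<dots> = h (real j * e)"
    unfolding increment_def using sum_lessThan_telescope[of "\<lambda>k. h (real k * e)" j] h0 by simp
  finally show ?thesis by (simp add: e_def)
qed

text \<open>The grid points of level \<open>n\<close> are also grid points of level \<open>m\<close>, so the coarse slope is the average
  of the fine one over each coarse cell.\<close>

lemma dyadic_slope_cell_integral:
  assumes h0: "h 0 = 0" and k: "k < n * 2 ^ n" and nm: "n \<le> m"
  shows "integral\<^sup>L lborel (\<lambda>s. dyadic_slope h m s *
      indicator {real k * (1 / 2 ^ n)..<real (Suc k) * (1 / 2 ^ n)} s) = increment h (1 / 2 ^ n) k"
proof -
  have conv: "real (j * 2 ^ (m - n)) * (1 / 2 ^ m) = real j * (1 / 2 ^ n)" for j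
  proof -
    have "(2::real) ^ m = 2 ^ (m - n) * 2 ^ n" using nm by (simp add: power_add[symmetric])
    then show ?thesis by simp
  qed
  have le: "j * 2 ^ (m - n) \<le> m * 2 ^ m" if "j \<le> n * 2 ^ n" for j
  proof -
    have "j * 2 ^ (m - n) \<le> n * 2 ^ n * 2 ^ (m - n)" using that by simp
    also have "\<dots> = n * 2 ^ m" using nm by (simp add: power_add[symmetric])
    also have "\<dots> \<le> m * 2 ^ m" using nm by simp
    finally show ?thesis .
  qed
  have int: "integral\<^sup>L lborel (\<lambda>s. dyadic_slope h m s * indicator {0..<real j * (1 / 2 ^ n)} s)
      = h (real j * (1 / 2 ^ n))" if "j \<le> n * 2 ^ n" for j
    using dyadic_slope_initial_integral[where h=h, OF h0 le[OF that]] unfolding conv .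
  have ind: "indicator {real k * (1 / 2 ^ n)..<real (Suc k) * (1 / 2 ^ n)} s
      = (indicator {0..<real (Suc k) * (1 / 2 ^ n)} s - indicator {0..<real k * (1 / 2 ^ n)} s :: real)" for s
  proof -
    have *: "indicator {a..<b} s = (indicator {0..<b} s - indicator {0..<a} s :: real)"
      if "0 \<le> a" "a \<le> b" for a b :: real
      using that by (auto simp: indicator_def)
    show ?thesis by (intro * mult_right_mono) auto
  qed
  show ?thesis
    unfolding ind right_diff_distrib increment_def
    using int[of k] int[of "Suc k"] k
    by (subst Bochner_Integration.integral_diff)
       (auto intro!: integrable_real_mult_indicator dyadic_slope_integrable simp del: of_nat_Suc)
qed

text \<open>Consequently the coarse slope is the orthogonal projection in \<open>L\<^sup>2\<close> of the fine one, and Pythagoras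
  (\<open>dyadic_slope_distance\<close>) expresses distances by differences of energies.\<close>

lemma dyadic_slope_inner_product:
  assumes h0: "h 0 = 0" and nm: "n \<le> m"
  shows "integrable lborel (\<lambda>s. dyadic_slope h m s * dyadic_slope h n s)"
    and "integral\<^sup>L lborel (\<lambda>s. dyadic_slope h m s * dyadic_slope h n s) = dyadic_energy h n"
proof -
  let ?I = "\<lambda>k. {real k * (1 / 2 ^ n)..<real (Suc k) * (1 / 2 ^ n)}"
  let ?c = "\<lambda>k. 2 ^ n * increment h (1 / 2 ^ n) k"
  have e: "dyadic_slope h m s * dyadic_slope h n s
      = (\<Sum>k<n * 2 ^ n. ?c k * (dyadic_slope h m s * indicator (?I k) s))" for s
    by (simp add: dyadic_slope_def[of h n] sum_distrib_left mult_ac)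
  have int: "integrable lborel (\<lambda>s. ?c k * (dyadic_slope h m s * indicator (?I k) s))" for k
    by (intro integrable_mult_right integrable_real_mult_indicator dyadic_slope_integrable) auto
  show "integrable lborel (\<lambda>s. dyadic_slope h m s * dyadic_slope h n s)"
    unfolding e by (intro Bochner_Integration.integrable_sum int)
  have "integral\<^sup>L lborel (\<lambda>s. dyadic_slope h m s * dyadic_slope h n s)
      = (\<Sum>k<n * 2 ^ n. ?c k * integral\<^sup>L lborel (\<lambda>s. dyadic_slope h m s * indicator (?I k) s))"
    unfolding e by (subst Bochner_Integration.integral_sum) (use int in simp_all)
  also have "\<dots> = dyadic_energy h n"
    unfolding dyadic_energy_def
    by (intro sum.cong refl) (use dyadic_slope_cell_integral[where h=h, OF h0 _ nm] in \<open>simp add: power2_eq_square\<close>)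
  finally show "integral\<^sup>L lborel (\<lambda>s. dyadic_slope h m s * dyadic_slope h n s) = dyadic_energy h n" .
qed

lemma dyadic_slope_distance:
  assumes h0: "h 0 = 0" and nm: "n \<le> m"
  shows "integrable lborel (\<lambda>s. (dyadic_slope h m s - dyadic_slope h n s)\<^sup>2)"
    and "integral\<^sup>L lborel (\<lambda>s. (dyadic_slope h m s - dyadic_slope h n s)\<^sup>2)
      = dyadic_energy h m - dyadic_energy h n"
proof -
  have e: "(dyadic_slope h m s - dyadic_slope h n s)\<^sup>2 = dyadic_slope h m s * dyadic_slope h m s
      - 2 * (dyadic_slope h m s * dyadic_slope h n s) + dyadic_slope h n s * dyadic_slope h n s" for s
    by (simp add: power2_eq_square algebra_simps)
  note ip = dyadic_slope_inner_product[where h=h, OF h0]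
  show "integrable lborel (\<lambda>s. (dyadic_slope h m s - dyadic_slope h n s)\<^sup>2)"
    unfolding e using ip(1)[of m m] ip(1)[OF nm] ip(1)[of n n] by simp
  show "integral\<^sup>L lborel (\<lambda>s. (dyadic_slope h m s - dyadic_slope h n s)\<^sup>2)
      = dyadic_energy h m - dyadic_energy h n"
    unfolding e using ip[of m m] ip[OF nm] ip[of n n] by simp
qed

lemma dyadic_energy_mono:
  assumes "h 0 = 0" "n \<le> m"
  shows "dyadic_energy h n \<le> dyadic_energy h m"
proof -
  have "0 \<le> integral\<^sup>L lborel (\<lambda>s. (dyadic_slope h m s - dyadic_slope h n s)\<^sup>2)"
    by (rule Bochner_Integration.integral_nonneg) simp
  then show ?thesis using dyadic_slope_distance(2)[where h=h, OF assms] by simp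
qed

text \<open>The energies increase to a finite limit; the rate along the subsequence is chosen small enough to
  stay summable after multiplication with \<open>2 ^ i\<close>.\<close>

lemma dyadic_slope_subsequence:
  assumes h0: "h 0 = 0" and B: "\<And>n. dyadic_energy h n \<le> B"
  obtains r where "\<And>i. i \<le> r i" and "\<And>i. r i \<le> r (Suc i)"
    and "\<And>i. dyadic_energy h (r (Suc i)) - dyadic_energy h (r i) \<le> (1 / 4) ^ i"
proof -
  have inc: "incseq (dyadic_energy h)"
    by (intro incseq_SucI dyadic_energy_mono h0) simp
  then obtain L where L: "dyadic_energy h \<longlonglongrightarrow> L" "\<And>n. dyadic_energy h n \<le> L"
    using incseq_convergent[OF inc] B by blast
  have "\<exists>N. \<forall>n\<ge>N. L - dyadic_energy h n < (1 / 4) ^ i" for i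
  proof -
    have "(0::real) < (1 / 4) ^ i" by simp
    then show ?thesis using LIMSEQ_D[OF L(1)] L(2) by (metis abs_minus_commute abs_of_nonneg diff_ge_0_iff_ge real_norm_def)
  qed
  then obtain N where N: "\<And>i n. N i \<le> n \<Longrightarrow> L - dyadic_energy h n < (1 / 4) ^ i" by metis
  define r where "r i = i + (\<Sum>j\<le>i. N j)" for i
  show ?thesis
  proof
    fix i
    show "i \<le> r i" "r i \<le> r (Suc i)" by (simp_all add: r_def)
    have "N i \<le> (\<Sum>j\<le>i. N j)" by (rule member_le_sum) auto
    then have "N i \<le> r i" by (simp add: r_def)
    then show "dyadic_energy h (r (Suc i)) - dyadic_energy h (r i) \<le> (1 / 4) ^ i"
      using N[of i "r i"] L(2)[of "r (Suc i)"] by linarith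
  qed
qed

text \<open>Let \<open>d i\<close> be the successive differences of slopes along the subsequence. Then \<open>F = (\<Sum>i. 2 ^ i * (d i)\<^sup>2)\<close> is
  integrable, and \<open>\<bar>d i\<bar> \<le> (1 / 2 ^ i + 2 ^ i * (d i)\<^sup>2) / 2\<close> by the inequality between the arithmetic and the
  geometric mean. Summing over \<open>i\<close>, the slopes converge almost everywhere and are dominated by
  \<open>1\<close> plus an integrable function, hence integrably so on bounded intervals.\<close>

lemma dyadic_slope_limit:
  assumes h0: "h 0 = 0" and B: "\<And>n. dyadic_energy h n \<le> B"
  obtains r G where "\<And>i. i \<le> r i" and "integrable lborel G"
    and "AE s in lborel. convergent (\<lambda>i. dyadic_slope h (r i) s)"
    and "AE s in lborel. \<forall>i. \<bar>dyadic_slope h (r i) s\<bar> \<le> 1 + G s"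
proof -
  obtain r where r: "\<And>i. i \<le> r i" "\<And>i. r i \<le> r (Suc i)"
    "\<And>i. dyadic_energy h (r (Suc i)) - dyadic_energy h (r i) \<le> (1 / 4) ^ i"
    using dyadic_slope_subsequence[where h=h, OF h0 B] by blast
  define d where "d i s = dyadic_slope h (r (Suc i)) s - dyadic_slope h (r i) s" for i s
  define f where "f i s = 2 ^ i * (d i s)\<^sup>2" for i s
  have f: "integrable lborel (f i)" "0 \<le> f i s" for i s
    unfolding f_def d_def by (intro integrable_mult_right dyadic_slope_distance(1)[where h=h, OF h0 r(2)]) simp
  have fi: "integral\<^sup>L lborel (f i) \<le> (1 / 2) ^ i" for i
  proof -
    have "integral\<^sup>L lborel (f i) = 2 ^ i * (dyadic_energy h (r (Suc i)) - dyadic_energy h (r i))"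
      unfolding f_def d_def by (simp add: dyadic_slope_distance(2)[where h=h, OF h0 r(2)])
    also have "\<dots> \<le> 2 ^ i * (1 / 4) ^ i" by (intro mult_left_mono r) simp
    also have "\<dots> = (1 / 2) ^ i" by (simp add: power_mult_distrib[symmetric])
    finally show ?thesis .
  qed
  have sm: "summable (\<lambda>i. (1 / 2 :: real) ^ i)" by (rule summable_geometric) simp
  have AEf: "AE s in lborel. summable (\<lambda>i. f i s)"
    by (rule AE_summable_of_summable_integrals[OF f fi sm])
  define F where "F s = (\<Sum>i. f i s)" for s
  have F: "integrable lborel F"
    unfolding F_def
  proof (rule integrable_suminf[OF f(1)])
    show "AE s in lborel. summable (\<lambda>i. norm (f i s))" using AEf f(2) by simp
    show "summable (\<lambda>i. \<integral>s. norm (f i s) \<partial>lborel)"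
      using fi f(2) by (intro summable_comparison_test'[OF sm, of 0]) (auto simp: Bochner_Integration.integral_nonneg)
  qed
  have d_le: "\<bar>d i s\<bar> \<le> ((1 / 2) ^ i + f i s) / 2" for i s
  proof -
    \<comment> \<open>the square that proves the inequality between the two means\<close>
    have "0 \<le> (1 / 2) ^ i * (2 ^ i * \<bar>d i s\<bar> - 1)\<^sup>2" by simp
    also have "\<dots> = (1 / 2) ^ i * ((2 ^ i)\<^sup>2 * (d i s)\<^sup>2 - 2 * 2 ^ i * \<bar>d i s\<bar> + 1)"
      by (simp add: power2_diff power_mult_distrib)
    also have "\<dots> = ((1 / 2) ^ i * 2 ^ i) * (2 ^ i * (d i s)\<^sup>2) - 2 * ((1 / 2) ^ i * 2 ^ i) * \<bar>d i s\<bar> + (1 / 2) ^ i"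
      by (simp add: algebra_simps power2_eq_square)
    also have "(1 / 2 :: real) ^ i * 2 ^ i = 1" by (simp add: power_mult_distrib[symmetric])
    finally show ?thesis by (simp add: f_def)
  qed
  have tele: "dyadic_slope h (r i) s = dyadic_slope h (r 0) s + (\<Sum>j<i. d j s)" for i s
    unfolding d_def using sum_lessThan_telescope[of "\<lambda>j. dyadic_slope h (r j) s" i] by simp
  show ?thesis
  proof
    show "integrable lborel (\<lambda>s. \<bar>dyadic_slope h (r 0) s\<bar> + F s / 2)"
      using F dyadic_slope_integrable by simp
    show "AE s in lborel. convergent (\<lambda>i. dyadic_slope h (r i) s)"
      using AEf
    proof eventually_elim
      fix s assume "summable (\<lambda>i. f i s)"
      then have "summable (\<lambda>i. ((1 / 2) ^ i + f i s) / 2)"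
        using sm by (intro summable_divide summable_add)
      then have "summable (\<lambda>i. d i s)"
        by (rule summable_comparison_test'[where N = 0]) (use d_le in auto)
      then have "convergent (\<lambda>i. \<Sum>j<i. d j s)" by (simp add: summable_iff_convergent)
      then have "convergent (\<lambda>i. dyadic_slope h (r 0) s + (\<Sum>j<i. d j s))"
        by (intro convergent_add convergent_const)
      then show "convergent (\<lambda>i. dyadic_slope h (r i) s)"
        by (simp only: tele[symmetric])
    qed
    show "AE s in lborel. \<forall>i. \<bar>dyadic_slope h (r i) s\<bar> \<le> 1 + (\<bar>dyadic_slope h (r 0) s\<bar> + F s / 2)"
      using AEf
    proof eventually_elim
      fix s assume smf: "summable (\<lambda>i. f i s)"
      show "\<forall>i. \<bar>dyadic_slope h (r i) s\<bar> \<le> 1 + (\<bar>dyadic_slope h (r 0) s\<bar> + F s / 2)"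
      proof
        fix i
        have "\<bar>dyadic_slope h (r i) s\<bar> \<le> \<bar>dyadic_slope h (r 0) s\<bar> + \<bar>\<Sum>j<i. d j s\<bar>"
          unfolding tele[of i] by (rule abs_triangle_ineq)
        also have "\<bar>\<Sum>j<i. d j s\<bar> \<le> (\<Sum>j<i. \<bar>d j s\<bar>)" by (rule sum_abs)
        also have "\<dots> \<le> (\<Sum>j<i. ((1 / 2) ^ j + f j s) / 2)" by (intro sum_mono d_le)
        also have "\<dots> = ((\<Sum>j<i. (1 / 2) ^ j) + (\<Sum>j<i. f j s)) / 2"
          by (simp add: sum.distrib sum_divide_distrib[symmetric])
        also have "\<dots> \<le> (2 + F s) / 2"
        proof -
          have "(\<Sum>j<i. (1 / 2 :: real) ^ j) \<le> (\<Sum>j. (1 / 2) ^ j)" by (intro sum_le_suminf sm) auto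
          then have "(\<Sum>j<i. (1 / 2 :: real) ^ j) \<le> 2" by (simp add: suminf_geometric)
          moreover have "(\<Sum>j<i. f j s) \<le> F s"
            unfolding F_def using f(2) by (intro sum_le_suminf smf) auto
          ultimately show ?thesis by simp
        qed
        finally show "\<bar>dyadic_slope h (r i) s\<bar> \<le> 1 + (\<bar>dyadic_slope h (r 0) s\<bar> + F s / 2)"
          by (simp add: add_divide_distrib)
      qed
    qed
  qed (rule r(1))
qed

text \<open>The limit \<open>g\<close> of the slopes is square integrable by Fatou's lemma and the bound on the energies. The
  integral of a slope from \<open>0\<close> to the dyadic number below \<open>t\<close> is the value of \<open>h\<close> there; in the limit
  dominated convergence and the continuity of \<open>h\<close> give \<open>h t\<close> as the integral of \<open>g\<close> over \<open>{0..t}\<close>.\<close>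

lemma cameron_martin_of_bounded_energy:
  assumes h: "h \<in> path_space" and B: "\<And>n. dyadic_energy h n \<le> B"
  shows "h \<in> cameron_martin_space"
proof -
  have h0: "h 0 = 0" using h by (simp add: path_space_def)
  obtain r G where r: "\<And>i. i \<le> r i" and G: "integrable lborel G"
    and conv: "AE s in lborel. convergent (\<lambda>i. dyadic_slope h (r i) s)"
    and dom: "AE s in lborel. \<forall>i. \<bar>dyadic_slope h (r i) s\<bar> \<le> 1 + G s"
    using dyadic_slope_limit[where h=h, OF h0 B] by blast
  define g where "g s = lim (\<lambda>i. dyadic_slope h (r i) s)" for s
  have [measurable]: "g \<in> borel_measurable borel" unfolding g_def[abs_def] by measurable
  have lim: "AE s in lborel. (\<lambda>i. dyadic_slope h (r i) s) \<longlonglongrightarrow> g s"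
    using conv by eventually_elim (simp add: g_def convergent_LIMSEQ_iff)
  have g2: "integrable lborel (\<lambda>s. (g s)\<^sup>2)"
  proof (rule integrableI_bounded)
    have "(\<integral>\<^sup>+s. ennreal ((g s)\<^sup>2) \<partial>lborel)
        = (\<integral>\<^sup>+s. liminf (\<lambda>i. ennreal ((dyadic_slope h (r i) s)\<^sup>2)) \<partial>lborel)"
    proof (rule nn_integral_cong_AE)
      show "AE s in lborel. ennreal ((g s)\<^sup>2) = liminf (\<lambda>i. ennreal ((dyadic_slope h (r i) s)\<^sup>2))"
        using lim
      proof eventually_elim
        fix s assume "(\<lambda>i. dyadic_slope h (r i) s) \<longlonglongrightarrow> g s"
        then have "(\<lambda>i. ennreal ((dyadic_slope h (r i) s)\<^sup>2)) \<longlonglongrightarrow> ennreal ((g s)\<^sup>2)"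
          by (intro tendsto_ennrealI tendsto_intros)
        from lim_imp_Liminf[OF _ this]
        show "ennreal ((g s)\<^sup>2) = liminf (\<lambda>i. ennreal ((dyadic_slope h (r i) s)\<^sup>2))" by simp
      qed
    qed
    also have "\<dots> \<le> liminf (\<lambda>i. \<integral>\<^sup>+s. ennreal ((dyadic_slope h (r i) s)\<^sup>2) \<partial>lborel)"
      by (rule nn_integral_liminf) measurable
    also have "\<dots> \<le> liminf (\<lambda>i. ennreal B)"
    proof (intro Liminf_mono always_eventually allI)
      fix i
      have "(\<integral>\<^sup>+s. ennreal ((dyadic_slope h (r i) s)\<^sup>2) \<partial>lborel) = ennreal (dyadic_energy h (r i))"
        using dyadic_slope_inner_product[where h=h, OF h0, of "r i" "r i"]
        by (subst nn_integral_eq_integral) (auto simp: power2_eq_square)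
      also have "\<dots> \<le> ennreal B" by (intro ennreal_leI B)
      finally show "(\<integral>\<^sup>+s. ennreal ((dyadic_slope h (r i) s)\<^sup>2) \<partial>lborel) \<le> ennreal B" .
    qed
    also have "\<dots> = ennreal B" by (simp add: Liminf_const)
    also have "\<dots> < \<infinity>" by simp
    finally show "(\<integral>\<^sup>+s. ennreal (norm ((g s)\<^sup>2)) \<partial>lborel) < \<infinity>" by simp
  qed measurable
  have rep: "h t = integral\<^sup>L lborel (\<lambda>s. indicator {0..t} s * g s)" if t: "0 \<le> t" for t
  proof -
    let ?t = "\<lambda>i. dyadic_floor (r i) t"
    have r_top: "filterlim r at_top sequentially"
      by (rule filterlim_at_top_mono[OF filterlim_ident always_eventually]) (use r in auto)
    have tt: "?t \<longlonglongrightarrow> t" by (rule filterlim_compose[OF dyadic_floor_tendsto r_top])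
    have "(\<lambda>i. integral\<^sup>L lborel (\<lambda>s. dyadic_slope h (r i) s * indicator {0..<?t i} s))
        \<longlonglongrightarrow> integral\<^sup>L lborel (\<lambda>s. indicator {0..t} s * g s)"
    proof (rule integral_dominated_convergence[where w="\<lambda>s. (1 + G s) * indicator {0..t} s"])
      show "integrable lborel (\<lambda>s. (1 + G s) * indicator {0..t} s)"
        unfolding distrib_right mult_1_left
        by (intro Bochner_Integration.integrable_add integrable_real_mult_indicator G)
          (use t in \<open>auto intro!: integrable_real_indicator\<close>)
      have "AE s in lborel. s \<noteq> t" by (rule AE_lborel_singleton)
      with lim show "AE s in lborel. (\<lambda>i. dyadic_slope h (r i) s * indicator {0..<?t i} s)
          \<longlonglongrightarrow> indicator {0..t} s * g s"
      proof eventually_elim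
        fix s assume l: "(\<lambda>i. dyadic_slope h (r i) s) \<longlonglongrightarrow> g s" and st: "s \<noteq> t"
        have "eventually (\<lambda>i. indicator {0..<?t i} s = (indicator {0..t} s :: real)) sequentially"
        proof (cases "s < t")
          case True
          from order_tendstoD(1)[OF tt True] show ?thesis
            by eventually_elim (use True in \<open>auto simp: indicator_def\<close>)
        next
          case False
          have "indicator {0..<?t i} s = (indicator {0..t} s :: real)" for i
            using False st dyadic_floor_le[of "r i" t] by (auto simp: indicator_def)
          then show ?thesis by (rule always_eventually[OF allI])
        qed
        then have "(\<lambda>i. indicator {0..<?t i} s) \<longlonglongrightarrow> (indicator {0..t} s :: real)"
          by (rule tendsto_eventually)
        from tendsto_mult[OF l this]
        show "(\<lambda>i. dyadic_slope h (r i) s * indicator {0..<?t i} s) \<longlonglongrightarrow> indicator {0..t} s * g s"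
          by (simp add: mult.commute)
      qed
      show "AE s in lborel. norm (dyadic_slope h (r i) s * indicator {0..<?t i} s)
          \<le> (1 + G s) * indicator {0..t} s" for i
        using dom
      proof eventually_elim
        fix s assume d: "\<forall>i. \<bar>dyadic_slope h (r i) s\<bar> \<le> 1 + G s"
        show "norm (dyadic_slope h (r i) s * indicator {0..<?t i} s) \<le> (1 + G s) * indicator {0..t} s"
          using d[rule_format, of i] dyadic_floor_le[of "r i" t]
          by (auto simp: indicator_def abs_mult)
      qed
    qed measurable
    moreover have "eventually (\<lambda>i. integral\<^sup>L lborel (\<lambda>s. dyadic_slope h (r i) s * indicator {0..<?t i} s) = h (?t i)) sequentially"
    proof -
      obtain i0 :: nat where i0: "t \<le> real i0" using real_arch_simple by blast
      have "integral\<^sup>L lborel (\<lambda>s. dyadic_slope h (r i) s * indicator {0..<?t i} s) = h (?t i)"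
        if i: "i0 \<le> i" for i
      proof -
        let ?j = "nat \<lfloor>2 ^ r i * t\<rfloor>"
        have "t \<le> real (r i)" using i0 i r[of i] by linarith
        then have "2 ^ r i * t \<le> real (r i * 2 ^ r i)" by simp
        then have "\<lfloor>2 ^ r i * t\<rfloor> \<le> int (r i * 2 ^ r i)" by linarith
        then have "?j \<le> r i * 2 ^ r i" by linarith
        from dyadic_slope_initial_integral[where h=h, OF h0 this] show ?thesis
          by (simp add: dyadic_floor_eq_nat[OF t])
      qed
      then show ?thesis by (auto simp: eventually_sequentially)
    qed
    ultimately have "(\<lambda>i. h (?t i)) \<longlonglongrightarrow> integral\<^sup>L lborel (\<lambda>s. indicator {0..t} s * g s)"
      by (rule Lim_transform_eventually)
    moreover have "(\<lambda>i. h (?t i)) \<longlonglongrightarrow> h t"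
      by (rule path_tendsto[OF h tt]) (rule dyadic_floor_nonneg[OF t])
    ultimately show ?thesis by (rule LIMSEQ_unique[symmetric])
  qed
  show ?thesis
    unfolding cameron_martin_space_def
  proof (intro CollectI bexI[of _ g] conjI)
    show gm: "g \<in> borel_measurable (lebesgue_on {0..})"
      by (intro measurable_restrict_space1 measurable_completion) simp
    have "integrable lebesgue (\<lambda>s. (g s)\<^sup>2)" using g2 by (simp add: integrable_completion)
    then show "integrable (lebesgue_on {0..}) (\<lambda>s. (g s)\<^sup>2)"
      using integrable_mult_indicator[of "{0..}" lebesgue "\<lambda>s. (g s)\<^sup>2"]
      by (subst integrable_restrict_space) auto
    have "(LINT s|lebesgue_on {0..t}. g s) = h t" if "0 \<le> t" for t
      using rep[OF that] by (simp add: integral_restrict_space integral_completion)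
    then show "h = (\<lambda>t\<in>{0..}. LINT s|lebesgue_on {0..t}. g s)"
      using h by (intro extensionalityI[of _ "{0..}"]) (auto simp: path_space_def)
  qed
qed

section \<open>Hoelder continuity of the shift\<close>

lemma increment_dilate:
  "0 \<le> s \<Longrightarrow> increment (dilate \<tau> x) s k = increment x (s * \<tau>) k"
  by (simp add: increment_def dilate_apply mult.assoc)

lemma increment_add: "increment (\<lambda>t. x t + y t) s k = increment x s k + increment y s k"
  by (simp add: increment_def)

lemma increment_dilate_add:
  "0 \<le> s \<Longrightarrow> increment (dilate \<tau> (\<lambda>t. x t + y t)) s k = increment (dilate \<tau> x) s k + increment (dilate \<tau> y) s k"
  by (simp add: increment_dilate increment_add)

lemma measurable_increment: "(\<lambda>x. increment x s k) \<in> borel_measurable path_borel"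
  unfolding increment_def by (intro borel_measurable_diff measurable_eval_path)

context
  fixes f :: "real \<Rightarrow> real" and c :: real and N n\<^sub>0 :: nat
  assumes f: "f \<in> path_space" and c: "0 \<le> c"
    and small: "\<And>n k. n\<^sub>0 \<le> n \<Longrightarrow> k < N * 2 ^ n \<Longrightarrow> \<bar>increment f (1 / 2 ^ n) k\<bar> \<le> c * (9/10) ^ n"
begin

text \<open>Rounding \<open>s\<close> at level \<open>j + 1\<close> instead of \<open>j\<close> changes it by nothing or by one cell of level \<open>j + 1\<close>, so the
  value of \<open>f\<close> changes by at most one controlled increment. The factor \<open>10\<close> is the sum of the
  geometric series of ratio \<open>9/10\<close>.\<close>

lemma chaining_step:
  assumes n: "n\<^sub>0 \<le> n" and s: "0 \<le> s" "s < real N"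
  shows "\<bar>f s - f (dyadic_floor n s)\<bar> \<le> 10 * c * (9/10) ^ n"
proof -
  have adj: "\<bar>f (dyadic_floor (Suc j) s) - f (dyadic_floor j s)\<bar> \<le> c * (9/10) ^ j" if j: "n\<^sub>0 \<le> j" for j
  proof -
    define a where "a = nat \<lfloor>2 ^ j * s\<rfloor>"
    have "0 \<le> 2 ^ j * s" using s by simp
    then have a: "real a \<le> 2 ^ j * s" "2 ^ j * s < real a + 1" unfolding a_def by linarith+
    have fj: "dyadic_floor j s = real (2 * a) * (1 / 2 ^ Suc j)"
      using s by (simp add: dyadic_floor_eq_nat a_def)
    have "nat \<lfloor>2 ^ Suc j * s\<rfloor> = 2 * a \<or> nat \<lfloor>2 ^ Suc j * s\<rfloor> = Suc (2 * a)"
    proof -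
      have "2 ^ Suc j * s = 2 * (2 ^ j * s)" by simp
      then have "real (2 * a) \<le> 2 ^ Suc j * s" "2 ^ Suc j * s < real (2 * a) + 2" using a by simp_all
      then show ?thesis by linarith
    qed
    then show ?thesis
    proof
      assume "nat \<lfloor>2 ^ Suc j * s\<rfloor> = 2 * a"
      then have "dyadic_floor (Suc j) s = dyadic_floor j s"
        using s unfolding fj by (subst dyadic_floor_eq_nat) simp_all
      then show ?thesis using c by simp
    next
      assume "nat \<lfloor>2 ^ Suc j * s\<rfloor> = Suc (2 * a)"
      then have fs: "dyadic_floor (Suc j) s = real (Suc (2 * a)) * (1 / 2 ^ Suc j)"
        using s by (subst dyadic_floor_eq_nat) simp_all
      have "2 ^ j * s < 2 ^ j * real N" using s by simp
      then have "real a < 2 ^ j * real N" using a by linarith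
      moreover have "2 ^ j * real N = real (N * 2 ^ j)" by simp
      ultimately have "real a < real (N * 2 ^ j)" by linarith
      then have "a < N * 2 ^ j" by linarith
      then have "2 * a < N * 2 ^ Suc j" by simp
      then have "\<bar>increment f (1 / 2 ^ Suc j) (2 * a)\<bar> \<le> c * (9/10) ^ Suc j"
        using j by (intro small) auto
      also have "\<dots> \<le> c * (9/10) ^ j" using c by (intro mult_left_mono power_decreasing) auto
      finally show ?thesis unfolding fs fj increment_def .
    qed
  qed
  have "\<bar>f (dyadic_floor (n + d) s) - f (dyadic_floor n s)\<bar> \<le> 10 * c * ((9/10) ^ n - (9/10) ^ (n + d))" for d
  proof (induction d)
    case (Suc d)
    have "\<bar>f (dyadic_floor (n + Suc d) s) - f (dyadic_floor n s)\<bar>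
        \<le> c * (9/10) ^ (n + d) + 10 * c * ((9/10) ^ n - (9/10) ^ (n + d))"
      using Suc adj[of "n + d"] n by simp
    also have "\<dots> = 10 * c * ((9/10) ^ n - (9/10) ^ (n + Suc d))" by (simp add: algebra_simps)
    finally show ?case .
  qed simp
  moreover have "10 * c * ((9/10) ^ n - (9/10) ^ (n + d)) \<le> 10 * c * (9/10) ^ n" for d
    using c by (intro mult_left_mono) auto
  ultimately have bound: "\<bar>f (dyadic_floor (n + d) s) - f (dyadic_floor n s)\<bar> \<le> 10 * c * (9/10) ^ n" for d
    by (rule order_trans)
  have "(\<lambda>d. dyadic_floor (d + n) s) \<longlonglongrightarrow> s" by (rule LIMSEQ_ignore_initial_segment[OF dyadic_floor_tendsto])
  then have "(\<lambda>d. f (dyadic_floor (d + n) s)) \<longlonglongrightarrow> f s"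
    by (rule path_tendsto[OF f]) (rule dyadic_floor_nonneg[OF s(1)])
  then have "(\<lambda>d. \<bar>f (dyadic_floor (d + n) s) - f (dyadic_floor n s)\<bar>) \<longlonglongrightarrow> \<bar>f s - f (dyadic_floor n s)\<bar>"
    by (intro tendsto_intros)
  then show ?thesis
    by (rule LIMSEQ_le_const2) (use bound in \<open>auto simp: add.commute\<close>)
qed

text \<open>Two points that are at most one mesh apart are rounded to the same or to neighbouring grid points;
  this costs one increment on top of the two chains.\<close>

lemma chaining:
  assumes n: "n\<^sub>0 \<le> n" and s: "0 \<le> s" "s \<le> t" "t < real N" "t - s \<le> 1 / 2 ^ n"
  shows "\<bar>f t - f s\<bar> \<le> 21 * c * (9/10) ^ n"
proof -
  define a where "a = nat \<lfloor>2 ^ n * s\<rfloor>"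
  define b where "b = nat \<lfloor>2 ^ n * t\<rfloor>"
  have floors: "(nat \<lfloor>v\<rfloor> = nat \<lfloor>u\<rfloor> \<or> nat \<lfloor>v\<rfloor> = Suc (nat \<lfloor>u\<rfloor>)) \<and> real (nat \<lfloor>u\<rfloor>) \<le> v"
    if "0 \<le> u" "u \<le> v" "v - u \<le> 1" for u v :: real
    using that by linarith
  have "2 ^ n * t - 2 ^ n * s = 2 ^ n * (t - s)" by (simp add: right_diff_distrib)
  also have "\<dots> \<le> 2 ^ n * (1 / 2 ^ n)" by (intro mult_left_mono s(4)) simp
  finally have "b = a \<or> b = Suc a" and at: "real a \<le> 2 ^ n * t"
    unfolding a_def b_def using floors[of "2 ^ n * s" "2 ^ n * t"] s by simp_all
  moreover have fl: "dyadic_floor n s = real a * (1 / 2 ^ n)" "dyadic_floor n t = real b * (1 / 2 ^ n)"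
    using s by (simp_all add: dyadic_floor_eq_nat a_def b_def)
  moreover have "a < N * 2 ^ n"
  proof -
    have "2 ^ n * t < 2 ^ n * real N" using s by simp
    then have "real a < 2 ^ n * real N" using at by linarith
    moreover have "2 ^ n * real N = real (N * 2 ^ n)" by simp
    ultimately have "real a < real (N * 2 ^ n)" by linarith
    then show ?thesis by linarith
  qed
  then have "\<bar>increment f (1 / 2 ^ n) a\<bar> \<le> c * (9/10) ^ n" using n by (intro small)
  ultimately have "\<bar>f (dyadic_floor n t) - f (dyadic_floor n s)\<bar> \<le> c * (9/10) ^ n"
    using c by (auto simp: increment_def simp del: of_nat_Suc)
  moreover have "\<bar>f s - f (dyadic_floor n s)\<bar> \<le> 10 * c * (9/10) ^ n"
    "\<bar>f t - f (dyadic_floor n t)\<bar> \<le> 10 * c * (9/10) ^ n"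
    using s n by (auto intro!: chaining_step)
  ultimately show ?thesis by linarith
qed

end

definition dyadically_regular :: "(real \<Rightarrow> real) \<Rightarrow> bool" where
  "dyadically_regular x \<longleftrightarrow>
     (\<forall>N. \<exists>n\<^sub>0. \<forall>n\<ge>n\<^sub>0. \<forall>k<N * 2 ^ n. \<bar>increment x (1 / 2 ^ n) k\<bar> \<le> (9/10) ^ n)"

lemma measurable_dyadically_regular: "Measurable.pred path_borel dyadically_regular"
proof -
  have [measurable]: "(\<lambda>x. increment x s k) \<in> borel_measurable path_borel" for s k
    by (rule measurable_increment)
  show ?thesis unfolding dyadically_regular_def[abs_def] by measurable
qed

text \<open>The fourth powers of the \<open>N * 2 ^ n\<close> increments have expectations of order \<open>1 / 4 ^ n\<close>. Dividing their sum by
  the fourth power of the threshold \<open>(9/10) ^ n\<close> leaves a quantity of order \<open>(5000/6561) ^ n\<close>; any base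
  whose fourth power exceeds \<open>1/2\<close> would make this summable.\<close>

lemma wiener_dyadically_regular:
  assumes P: "wiener_measure P" and \<tau>: "0 < \<tau>"
  shows "AE w in P. dyadically_regular (dilate \<tau> w)"
  unfolding dyadically_regular_def AE_all_countable
proof
  fix N :: nat
  interpret prob_space P using P by (simp add: wiener_measure_def)
  define f where "f n w = (\<Sum>k<N * 2 ^ n. (increment w (\<tau> / 2 ^ n) k) ^ 4) / (9/10) ^ (4 * n)" for n w
  have s: "0 < \<tau> / 2 ^ n" for n using \<tau> by simp
  note m = gaussian_fourth_moment[OF wiener_increments(1)[OF P s] s wiener_increments(2)[OF P s]]
  have "AE w in P. (\<lambda>n. f n w) \<longlonglongrightarrow> 0"
  proof (rule AE_tendsto_zero_of_summable_integrals)
    show "integrable P (f n)" for n unfolding f_def using m(1) by simp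
    show "0 \<le> f n w" for n w unfolding f_def by (intro divide_nonneg_pos sum_nonneg) auto
    show "expectation (f n) \<le> 3 * \<tau>\<^sup>2 * N * (5000 / 6561) ^ n" for n
    proof -
      have "expectation (f n) = 3 * (\<tau> / 2 ^ n)\<^sup>2 * real (N * 2 ^ n) / (9/10) ^ (4 * n)"
        unfolding f_def using m(2) by simp
      also have "\<dots> = 3 * \<tau>\<^sup>2 * N / (2 ^ n * (9/10) ^ (4 * n))"
        by (simp add: power_divide power2_eq_square del: power_mult)
      also have "2 ^ n * (9/10) ^ (4 * n) = (2 * (9/10 :: real) ^ 4) ^ n"
        by (simp only: power_mult power_mult_distrib)
      also have "2 * (9/10 :: real) ^ 4 = 6561 / 5000" by (simp add: power_divide)
      also have "3 * \<tau>\<^sup>2 * N / (6561 / 5000) ^ n = 3 * \<tau>\<^sup>2 * N * (5000 / 6561) ^ n"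
        by (simp add: power_divide)
      finally show ?thesis by simp
    qed
    show "summable (\<lambda>n. 3 * \<tau>\<^sup>2 * N * (5000 / 6561) ^ n)"
      by (intro summable_mult summable_geometric) simp
  qed
  then show "AE w in P. \<exists>n\<^sub>0. \<forall>n\<ge>n\<^sub>0. \<forall>k<N * 2 ^ n. \<bar>increment (dilate \<tau> w) (1 / 2 ^ n) k\<bar> \<le> (9/10) ^ n"
  proof eventually_elim
    fix w assume "(\<lambda>n. f n w) \<longlonglongrightarrow> 0"
    from order_tendstoD(2)[OF this zero_less_one]
    obtain n\<^sub>0 where n0: "\<And>n. n\<^sub>0 \<le> n \<Longrightarrow> f n w < 1" by (auto simp: eventually_sequentially)
    have "\<bar>increment (dilate \<tau> w) (1 / 2 ^ n) k\<bar> \<le> (9/10) ^ n" if n: "n\<^sub>0 \<le> n" and k: "k < N * 2 ^ n" for n k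
    proof -
      let ?i = "increment w (\<tau> / 2 ^ n) k"
      have "\<bar>?i\<bar> ^ 4 = ?i ^ 4" by simp
      also have "\<dots> \<le> (\<Sum>k<N * 2 ^ n. (increment w (\<tau> / 2 ^ n) k) ^ 4)"
        by (rule member_le_sum) (use k in auto)
      also have "\<dots> < (9/10) ^ (4 * n)" using n0[OF n] by (simp add: f_def)
      also have "\<dots> = ((9/10) ^ n) ^ 4" by (simp add: power_mult[symmetric] mult.commute)
      finally have "\<bar>?i\<bar> < (9/10) ^ n" by (rule power_less_imp_less_base) simp
      then show ?thesis by (simp add: increment_dilate)
    qed
    then show "\<exists>n\<^sub>0. \<forall>n\<ge>n\<^sub>0. \<forall>k<N * 2 ^ n. \<bar>increment (dilate \<tau> w) (1 / 2 ^ n) k\<bar> \<le> (9/10) ^ n"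
      by blast
  qed
qed

text \<open>On the time scale \<open>\<tau>\<close>, \<open>h\<close> is the difference of two regular paths, so chaining applies to \<open>dilate \<tau> h\<close>.
  Returning to the original time scale shifts the level by some \<open>p\<close> with \<open>1 / 2 ^ p < \<tau>\<close>, which is
  absorbed in the constant.\<close>

lemma modulus_of_continuity:
  assumes h: "h \<in> path_space" and \<tau>: "0 < \<tau>"
    and reg: "dyadically_regular (dilate \<tau> w)" "dyadically_regular (dilate \<tau> (\<lambda>t. w t + h t))"
  shows "\<exists>C n\<^sub>0. \<forall>n\<ge>n\<^sub>0. \<forall>s t. 0 \<le> s \<longrightarrow> s \<le> t \<longrightarrow> t \<le> T \<longrightarrow> t - s \<le> 1 / 2 ^ n \<longrightarrow>
     \<bar>h t - h s\<bar> \<le> C * (9/10) ^ n"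
proof -
  let ?f = "dilate \<tau> h"
  have f: "?f \<in> path_space"
    using h \<tau> by (intro dilate_in_path_space) (auto simp: path_space_def)
  obtain N :: nat where N: "T / \<tau> < real N" using reals_Archimedean2 by blast
  obtain n1 n2 where
    n1: "\<And>n k. n1 \<le> n \<Longrightarrow> k < N * 2 ^ n \<Longrightarrow> \<bar>increment (dilate \<tau> w) (1 / 2 ^ n) k\<bar> \<le> (9/10) ^ n" and
    n2: "\<And>n k. n2 \<le> n \<Longrightarrow> k < N * 2 ^ n \<Longrightarrow>
      \<bar>increment (dilate \<tau> (\<lambda>t. w t + h t)) (1 / 2 ^ n) k\<bar> \<le> (9/10) ^ n"
    using reg unfolding dyadically_regular_def by meson
  have small: "\<bar>increment ?f (1 / 2 ^ n) k\<bar> \<le> 2 * (9/10) ^ n"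
    if "max n1 n2 \<le> n" "k < N * 2 ^ n" for n k
    using n1[of n k] n2[of n k] that by (simp add: increment_dilate_add)
  obtain p where p: "(1 / 2) ^ p < \<tau>" using real_arch_pow_inv[OF \<tau>, of "1/2"] by auto
  have "\<bar>h t - h s\<bar> \<le> (42 * (10/9) ^ p) * (9/10) ^ n"
    if n: "max n1 n2 + p \<le> n" and st: "0 \<le> s" "s \<le> t" "t \<le> T" "t - s \<le> 1 / 2 ^ n" for n s t
  proof -
    define m where "m = n - p"
    have nm: "n = m + p" "max n1 n2 \<le> m" using n by (auto simp: m_def)
    have "t - s \<le> 1 / 2 ^ m * (1 / 2) ^ p" using st(4) by (simp add: nm(1) power_add power_one_over)
    also have "\<dots> \<le> 1 / 2 ^ m * \<tau>" using p by (intro mult_left_mono) auto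
    finally have "t / \<tau> - s / \<tau> \<le> 1 / 2 ^ m"
      using \<tau> by (simp add: diff_divide_distrib[symmetric] pos_divide_le_eq)
    moreover have "t / \<tau> < real N" using st(3) N \<tau> by (meson divide_right_mono le_less_trans less_imp_le)
    moreover have "0 \<le> s / \<tau>" "s / \<tau> \<le> t / \<tau>" using st \<tau> by (auto intro: divide_right_mono)
    ultimately have "\<bar>?f (t / \<tau>) - ?f (s / \<tau>)\<bar> \<le> 21 * 2 * (9/10) ^ m"
      using nm(2) by (intro chaining[where N = N and n\<^sub>0 = "max n1 n2", OF f _ small]) simp_all
    moreover have "(9/10 :: real) ^ m = (10/9) ^ p * (9/10) ^ n"
      by (simp add: nm(1) power_add power_mult_distrib[symmetric] mult.left_commute)
    moreover have "0 \<le> t / \<tau>" using st \<tau> by simp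
    ultimately show ?thesis using \<tau> st by (simp add: dilate_apply)
  qed
  then show ?thesis by blast
qed

section \<open>Detection of the shift by correlation\<close>

definition covariation :: "(real \<Rightarrow> real) \<Rightarrow> (real \<Rightarrow> real) \<Rightarrow> nat \<Rightarrow> real" where
  "covariation x y n = (\<Sum>k<2 ^ n. increment x (1 / 2 ^ n) k * increment y (1 / 2 ^ n) k)"

lemma covariation_dilate_add_left:
  "covariation (dilate \<tau> (\<lambda>t. x t + y t)) z n = covariation (dilate \<tau> x) z n + covariation (dilate \<tau> y) z n"
  by (simp add: covariation_def increment_dilate_add distrib_right sum.distrib)

lemma covariation_self: "covariation x x n = (\<Sum>k<2 ^ n. (increment x (1 / 2 ^ n) k)\<^sup>2)"
  by (simp add: covariation_def power2_eq_square)

lemma covariation_self_nonneg: "0 \<le> covariation x x n"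
  unfolding covariation_self by (intro sum_nonneg) simp

lemma measurable_covariation: "(\<lambda>x. covariation x y n) \<in> borel_measurable path_borel"
  unfolding covariation_def
  by (intro borel_measurable_sum borel_measurable_times measurable_increment borel_measurable_const)

lemma measurable_covariation_self: "(\<lambda>x. covariation x x n) \<in> borel_measurable path_borel"
  unfolding covariation_def
  by (intro borel_measurable_sum borel_measurable_times measurable_increment)

lemma covariation_dilate:
  "covariation (dilate \<tau> w) y n = (\<Sum>k<2 ^ n. increment y (1 / 2 ^ n) k * increment w (\<tau> / 2 ^ n) k)"
  by (simp add: covariation_def increment_dilate mult.commute)

text \<open>The function \<open>y\<close> runs through the time changes of \<open>h\<close> by the points of a net of mesh \<open>1 / 16 ^ n\<close> in
  \<open>{0..n}\<close>. It counts as detected in \<open>x\<close> when its covariation with \<open>x\<close> reaches half of its own quadratic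
  variation; candidates whose quadratic variation is below \<open>\<delta>\<close> are disregarded.\<close>

definition undetected :: "(real \<Rightarrow> real) \<Rightarrow> real \<Rightarrow> (real \<Rightarrow> real) \<Rightarrow> bool" where
  "undetected h \<delta> x \<longleftrightarrow> (\<exists>n\<^sub>0. \<forall>n\<ge>n\<^sub>0. \<forall>j\<le>n * 16 ^ n.
     let y = dilate (real j / 16 ^ n) h in
       \<delta> \<le> covariation y y n \<longrightarrow> covariation x y n < covariation y y n / 2)"

lemma measurable_undetected: "Measurable.pred path_borel (undetected h \<delta>)"
proof -
  have [measurable]: "(\<lambda>x. covariation x y n) \<in> borel_measurable path_borel" for y n
    by (rule measurable_covariation)
  show ?thesis unfolding undetected_def[abs_def] Let_def by measurable
qed

text \<open>The lower bound \<open>exp u \<ge> (u / 6) ^ 6\<close> is enough, because \<open>2 ^ 6\<close> exceeds \<open>2 * 16\<close>.\<close>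

lemma summable_net_times_gaussian:
  assumes c: "0 < c"
  shows "summable (\<lambda>n. (real n * 16 ^ n + 1) * exp (- (c * 2 ^ n)))"
proof (rule summable_comparison_test'[where N = 0])
  show "summable (\<lambda>n. (6 / c) ^ 6 * (1 / 2) ^ n)" by (intro summable_mult summable_geometric) simp
  fix n :: nat
  have "(c * 2 ^ n / 6) ^ 6 \<le> (1 + c * 2 ^ n / 6) ^ 6" using c by (intro power_mono) simp_all
  also have "\<dots> \<le> exp (c * 2 ^ n / 6) ^ 6"
    using c by (intro power_mono exp_ge_add_one_self) (simp add: add_nonneg_nonneg)
  also have "\<dots> = exp (c * 2 ^ n)" by (simp add: exp_of_nat_mult[symmetric])
  finally have e: "(c / 6) ^ 6 * 64 ^ n \<le> exp (c * 2 ^ n)"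
  proof -
    have "(c * 2 ^ n / 6) ^ 6 = (c / 6 * 2 ^ n) ^ 6" by simp
    also have "\<dots> = (c / 6) ^ 6 * (2 ^ n) ^ 6" by (rule power_mult_distrib)
    also have "(2 ^ n :: real) ^ 6 = (2 ^ 6) ^ n" by (simp only: power_mult[symmetric] mult.commute)
    also have "(2 ^ 6 :: real) = 64" by simp
    finally show "(c * 2 ^ n / 6) ^ 6 \<le> exp (c * 2 ^ n) \<Longrightarrow> ?thesis" by simp
  qed
  have pos: "0 < (c / 6) ^ 6 * 64 ^ n" using c by simp
  have "exp (- (c * 2 ^ n)) = inverse (exp (c * 2 ^ n))" by (rule exp_minus)
  also have "\<dots> \<le> inverse ((c / 6) ^ 6 * 64 ^ n)" by (rule le_imp_inverse_le[OF e pos])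
  also have "\<dots> = inverse (c / 6) ^ 6 * inverse 64 ^ n"
    by (simp only: inverse_mult_distrib power_inverse)
  also have "inverse (c / 6) = 6 / c" by simp
  also have "inverse (64 :: real) = 1 / 64" by simp
  finally have e': "exp (- (c * 2 ^ n)) \<le> (6 / c) ^ 6 * (1 / 64) ^ n" .
  have "Suc n \<le> 2 ^ n" by (induction n) auto
  then have "real (Suc n) \<le> real (2 ^ n)" by (simp only: of_nat_le_iff)
  then have "real n + 1 \<le> 2 ^ n" by simp
  then have "(real n + 1) * 16 ^ n \<le> 2 ^ n * 16 ^ n" by (intro mult_right_mono) auto
  moreover have "(1::real) \<le> 16 ^ n" by simp
  ultimately have "real n * 16 ^ n + 1 \<le> 2 ^ n * 16 ^ n"
    unfolding distrib_right mult_1_left by linarith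
  also have "\<dots> = 32 ^ n" by (simp only: power_mult_distrib[symmetric]) simp
  finally have "(real n * 16 ^ n + 1) * exp (- (c * 2 ^ n)) \<le> 32 ^ n * ((6 / c) ^ 6 * (1 / 64) ^ n)"
    by (intro mult_mono e') auto
  also have "\<dots> = (6 / c) ^ 6 * (32 ^ n * (1 / 64) ^ n)" by simp
  also have "(32::real) ^ n * (1 / 64) ^ n = (1 / 2) ^ n" by (simp only: power_mult_distrib[symmetric]) simp
  finally show "norm ((real n * 16 ^ n + 1) * exp (- (c * 2 ^ n))) \<le> (6 / c) ^ 6 * (1 / 2) ^ n"
    by (simp add: abs_mult)
qed

text \<open>At level \<open>n\<close> the covariation of \<open>dilate \<tau> w\<close> with a candidate of quadratic variation \<open>q\<close> is Gaussian with
  variance \<open>\<tau> * q / 2 ^ n\<close>. The exponential Markov inequality, with the optimal parameter \<open>l n\<close>, bounds the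
  probability of detection by \<open>exp (- q * 2 ^ n / (8 * \<tau>))\<close>. This is summable over \<open>n\<close> even after
  multiplication with the number of candidates.\<close>

lemma wiener_undetected:
  assumes P: "wiener_measure P" and \<tau>: "0 < \<tau>" and \<delta>: "0 < \<delta>"
  shows "AE w in P. undetected h \<delta> (dilate \<tau> w)"
proof -
  interpret prob_space P using P by (simp add: wiener_measure_def)
  define y where "y n j = dilate (real j / 16 ^ n) h" for n j :: nat
  define q where "q n j = covariation (y n j) (y n j) n" for n j
  define l :: "nat \<Rightarrow> real" where "l n = 2 ^ n / (2 * \<tau>)" for n
  define E where "E n j w = exp (l n * covariation (dilate \<tau> w) (y n j) n)" for n j w
  define f where "f n w = (\<Sum>j\<le>n * 16 ^ n. if \<delta> \<le> q n j then exp (- (l n * q n j / 2)) * E n j w else 0)" for n w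
  have s: "0 < \<tau> / 2 ^ n" for n using \<tau> by simp
  have E: "integrable P (E n j)" "expectation (E n j) = exp (2 ^ n * q n j / (8 * \<tau>))" for n j
  proof -
    note m = gaussian_linear_exp_moment[OF wiener_increments(1)[OF P s] s wiener_increments(2)[OF P s],
        where N = "2 ^ n" and a = "\<lambda>k. l n * increment (y n j) (1 / 2 ^ n) k"]
    have e: "E n j w = exp (\<Sum>k<2 ^ n. l n * increment (y n j) (1 / 2 ^ n) k * increment w (\<tau> / 2 ^ n) k)" for w
      by (simp add: E_def covariation_dilate sum_distrib_left mult.assoc)
    have v: "(\<Sum>k<2 ^ n. (l n * increment (y n j) (1 / 2 ^ n) k)\<^sup>2) = (l n)\<^sup>2 * q n j"
      by (simp add: q_def covariation_self power_mult_distrib sum_distrib_left)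
    have "\<tau> / 2 ^ n * ((l n)\<^sup>2 * q n j) / 2 = 2 ^ n * q n j / (8 * \<tau>)"
      using \<tau> by (simp add: l_def power2_eq_square field_simps)
    then show "integrable P (E n j)" "expectation (E n j) = exp (2 ^ n * q n j / (8 * \<tau>))"
      using m[of n] unfolding e v by simp_all
  qed
  have Eif: "integrable P (\<lambda>w. if \<delta> \<le> q n j then exp (- (l n * q n j / 2)) * E n j w else 0)" for n j
    using E(1) by (cases "\<delta> \<le> q n j") simp_all
  have "AE w in P. (\<lambda>n. f n w) \<longlonglongrightarrow> 0"
  proof (rule AE_tendsto_zero_of_summable_integrals)
    show "integrable P (f n)" for n
      unfolding f_def by (intro Bochner_Integration.integrable_sum Eif)
    show "0 \<le> f n w" for n w
      unfolding f_def E_def by (intro sum_nonneg) simp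
    show "expectation (f n) \<le> (real n * 16 ^ n + 1) * exp (- (\<delta> / (8 * \<tau>) * 2 ^ n))" for n
    proof -
      have "expectation (f n) = (\<Sum>j\<le>n * 16 ^ n. expectation (\<lambda>w. if \<delta> \<le> q n j then exp (- (l n * q n j / 2)) * E n j w else 0))"
        unfolding f_def by (intro Bochner_Integration.integral_sum Eif)
      also have "\<dots> \<le> (\<Sum>j\<le>n * 16 ^ n. exp (- (\<delta> / (8 * \<tau>) * 2 ^ n)))"
      proof (intro sum_mono)
        fix j
        have "exp (- (l n * q n j / 2)) * expectation (E n j) = exp (- (q n j / (8 * \<tau>) * 2 ^ n))"
          unfolding E(2) exp_add[symmetric] using \<tau> by (simp add: l_def field_simps)
        moreover have "- (q n j / (8 * \<tau>) * 2 ^ n) \<le> - (\<delta> / (8 * \<tau>) * 2 ^ n)" if "\<delta> \<le> q n j"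
          using that \<tau> by (simp add: divide_right_mono)
        ultimately show "expectation (\<lambda>w. if \<delta> \<le> q n j then exp (- (l n * q n j / 2)) * E n j w else 0)
            \<le> exp (- (\<delta> / (8 * \<tau>) * 2 ^ n))"
          by (cases "\<delta> \<le> q n j") simp_all
      qed
      also have "\<dots> = (real n * 16 ^ n + 1) * exp (- (\<delta> / (8 * \<tau>) * 2 ^ n))" by (simp add: add.commute)
      finally show ?thesis .
    qed
    show "summable (\<lambda>n. (real n * 16 ^ n + 1) * exp (- (\<delta> / (8 * \<tau>) * 2 ^ n)))"
      by (rule summable_net_times_gaussian) (use \<delta> \<tau> in simp)
  qed
  then show ?thesis
  proof eventually_elim
    fix w assume "(\<lambda>n. f n w) \<longlonglongrightarrow> 0"
    from order_tendstoD(2)[OF this zero_less_one]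
    obtain n0 where n0: "\<And>n. n0 \<le> n \<Longrightarrow> f n w < 1" by (auto simp: eventually_sequentially)
    have "covariation (dilate \<tau> w) (y n j) n < q n j / 2"
      if n: "n0 \<le> n" and j: "j \<le> n * 16 ^ n" and d: "\<delta> \<le> q n j" for n j
    proof -
      have "exp (- (l n * q n j / 2)) * E n j w \<le> f n w"
        unfolding f_def using d j E_def
        by (intro order_trans[OF _ member_le_sum[of j]]) auto
      moreover have "exp (- (l n * q n j / 2)) * E n j w
          = exp (l n * (covariation (dilate \<tau> w) (y n j) n - q n j / 2))"
        by (simp add: E_def exp_add[symmetric] right_diff_distrib)
      ultimately have "exp (l n * (covariation (dilate \<tau> w) (y n j) n - q n j / 2)) < 1"
        using n0[OF n] by linarith
      then have "l n * (covariation (dilate \<tau> w) (y n j) n - q n j / 2) < 0" by simp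
      moreover have "0 < l n" using \<tau> by (simp add: l_def)
      ultimately show ?thesis by (simp add: mult_less_0_iff)
    qed
    then show "undetected h \<delta> (dilate \<tau> w)"
      unfolding undetected_def Let_def y_def q_def by blast
  qed
qed

text \<open>If \<open>y\<close> is a good approximation of \<open>x\<close>, then \<open>y\<close> has about the same quadratic variation as \<open>x\<close>, and nearly
  all of it appears as covariation with \<open>x\<close>. Both follow by expanding squares of sums.\<close>

lemma covariation_close:
  assumes e: "(\<Sum>k<2 ^ n. (increment x (1 / 2 ^ n) k - increment y (1 / 2 ^ n) k)\<^sup>2) \<le> \<delta> / 8"
    and z: "4 * \<delta> \<le> covariation x x n" and \<delta>: "0 < \<delta>"
  shows "\<delta> \<le> covariation y y n" and "5 / 8 * covariation y y n \<le> covariation x y n"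
proof -
  let ?x = "increment x (1 / 2 ^ n)" and ?y = "increment y (1 / 2 ^ n)"
  define \<epsilon> where "\<epsilon> = (\<Sum>k<2 ^ n. (?x k - ?y k)\<^sup>2)"
  have pol: "\<epsilon> = covariation x x n - 2 * covariation x y n + covariation y y n"
    unfolding \<epsilon>_def covariation_def sum_distrib_left sum_subtractf[symmetric] sum.distrib[symmetric]
    by (intro sum.cong refl) (simp add: power2_eq_square algebra_simps)
  \<comment> \<open>This square and the next one give the two parallelogram-type bounds \<open>\<parallel>x\<parallel>\<^sup>2 \<le> 2 \<parallel>y\<parallel>\<^sup>2 + 2 \<parallel>x - y\<parallel>\<^sup>2\<close> and its mirror image.\<close>
  have "0 \<le> (\<Sum>k<2 ^ n. (?x k - 2 * ?y k)\<^sup>2)" by (intro sum_nonneg) simp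
  also have "\<dots> = covariation x x n - 4 * covariation x y n + 4 * covariation y y n"
    unfolding covariation_def sum_distrib_left sum_subtractf[symmetric] sum.distrib[symmetric]
    by (intro sum.cong refl) (simp add: power2_eq_square algebra_simps)
  finally have 1: "covariation x x n \<le> 2 * covariation y y n + 2 * \<epsilon>" using pol by linarith
  have "0 \<le> (\<Sum>k<2 ^ n. (2 * ?x k - ?y k)\<^sup>2)" by (intro sum_nonneg) simp
  also have "\<dots> = 4 * covariation x x n - 4 * covariation x y n + covariation y y n"
    unfolding covariation_def sum_distrib_left sum_subtractf[symmetric] sum.distrib[symmetric]
    by (intro sum.cong refl) (simp add: power2_eq_square algebra_simps)
  finally have 2: "covariation y y n \<le> 2 * covariation x x n + 2 * \<epsilon>" using pol by linarith
  have \<epsilon>: "\<epsilon> \<le> \<delta> / 8" using e by (simp add: \<epsilon>_def)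
  show "\<delta> \<le> covariation y y n" using 1 z \<epsilon> \<delta> by linarith
  then show "5 / 8 * covariation y y n \<le> covariation x y n" using pol 2 \<epsilon> by linarith
qed

text \<open>Rounding \<open>\<tau>\<close> down to the net moves all times in the unit interval by at most \<open>1 / 2 ^ (4 * n)\<close>, so each of
  the \<open>2 ^ n\<close> increments changes by at most \<open>2 * C * (9/10) ^ (4 * n)\<close>. The mesh of the net is chosen to make the
  base \<open>2 * (9/10) ^ 8\<close> of the resulting bound smaller than \<open>1\<close>.\<close>

lemma net_approximation:
  assumes mod: "\<And>n s t. n\<^sub>0 \<le> n \<Longrightarrow> 0 \<le> s \<Longrightarrow> s \<le> t \<Longrightarrow> t \<le> \<tau> \<Longrightarrow> t - s \<le> 1 / 2 ^ n \<Longrightarrow>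
      \<bar>h t - h s\<bar> \<le> C * (9/10) ^ n"
    and \<tau>: "0 < \<tau>"
  defines "z \<equiv> dilate \<tau> h" and "y \<equiv> \<lambda>n. dilate (dyadic_floor (4 * n) \<tau>) h"
  shows "(\<lambda>n. \<Sum>k<2 ^ n. (increment z (1 / 2 ^ n) k - increment (y n) (1 / 2 ^ n) k)\<^sup>2) \<longlonglongrightarrow> 0"
proof (rule tendsto_sandwich[where f = "\<lambda>_. 0" and h = "\<lambda>n. 4 * C\<^sup>2 * (2 * (9/10) ^ 8) ^ n"])
  show "(\<lambda>n. 4 * C\<^sup>2 * (2 * (9/10) ^ 8) ^ n) \<longlonglongrightarrow> 0"
    by (intro tendsto_mult_right_zero LIMSEQ_realpow_zero) (simp_all add: power_divide)
  show "\<forall>\<^sub>F n in sequentially. (\<Sum>k<2 ^ n. (increment z (1 / 2 ^ n) k - increment (y n) (1 / 2 ^ n) k)\<^sup>2)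
      \<le> 4 * C\<^sup>2 * (2 * (9/10) ^ 8) ^ n"
    unfolding eventually_sequentially
  proof (intro exI allI impI)
    fix n assume n: "n\<^sub>0 \<le> n"
    let ?\<tau>' = "dyadic_floor (4 * n) \<tau>" and ?b = "C * (9/10) ^ (4 * n)"
    have \<tau>': "0 \<le> ?\<tau>'" "?\<tau>' \<le> \<tau>" "\<tau> - ?\<tau>' \<le> 1 / 2 ^ (4 * n)"
      using dyadic_floor_nonneg[of \<tau> "4 * n"] dyadic_floor_le[of "4 * n" \<tau>] dyadic_floor_gt[of \<tau> "4 * n"] \<tau>
      by auto
    have pt: "\<bar>z u - y n u\<bar> \<le> ?b" if u: "0 \<le> u" "u \<le> 1" for u
    proof -
      have "u * \<tau> - u * ?\<tau>' = u * (\<tau> - ?\<tau>')" by (simp add: right_diff_distrib)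
      also have "\<dots> \<le> 1 * (\<tau> - ?\<tau>')" using u \<tau>' by (intro mult_right_mono) auto
      also have "\<dots> \<le> 1 / 2 ^ (4 * n)" using \<tau>'(3) by (simp only: mult_1_left)
      finally have "u * \<tau> - u * ?\<tau>' \<le> 1 / 2 ^ (4 * n)" .
      moreover have "u * \<tau> \<le> \<tau>" using u \<tau> by (simp add: mult_left_le_one_le)
      moreover have "u * ?\<tau>' \<le> u * \<tau>" using u \<tau>' by (intro mult_left_mono) auto
      ultimately show ?thesis
        using mod[of "4 * n" "u * ?\<tau>'" "u * \<tau>"] n u \<tau>' by (simp add: z_def y_def dilate_apply)
    qed
    have "(increment z (1 / 2 ^ n) k - increment (y n) (1 / 2 ^ n) k)\<^sup>2 \<le> (2 * ?b)\<^sup>2" if k: "k < 2 ^ n" for k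
    proof -
      have "real (Suc k) \<le> 2 ^ n" using k by (metis Suc_leI of_nat_le_iff of_nat_numeral of_nat_power)
      moreover have "real k \<le> real (Suc k)" by simp
      ultimately have "real k \<le> 2 ^ n" "real (Suc k) \<le> 2 ^ n" by linarith+
      then have "real (Suc k) * (1 / 2 ^ n) \<le> 1" "real k * (1 / 2 ^ n) \<le> 1"
        by (simp_all only: times_divide_eq_right mult_1_right pos_divide_le_eq zero_less_power zero_less_numeral mult_1_left)
      then have "\<bar>increment z (1 / 2 ^ n) k - increment (y n) (1 / 2 ^ n) k\<bar> \<le> 2 * ?b"
        using pt[of "real (Suc k) * (1 / 2 ^ n)"] pt[of "real k * (1 / 2 ^ n)"]
        unfolding increment_def by (simp del: of_nat_Suc)
      then show ?thesis by (metis abs_ge_zero power2_abs power_mono)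
    qed
    then have "(\<Sum>k<2 ^ n. (increment z (1 / 2 ^ n) k - increment (y n) (1 / 2 ^ n) k)\<^sup>2)
        \<le> (\<Sum>k<(2::nat) ^ n. (2 * ?b)\<^sup>2)" by (intro sum_mono) auto
    also have "\<dots> = 4 * C\<^sup>2 * (2 ^ n * ((9/10) ^ (4 * n))\<^sup>2)"
      by (simp add: power_mult_distrib)
    also have "((9/10 :: real) ^ (4 * n))\<^sup>2 = ((9/10) ^ 8) ^ n"
      unfolding power_mult[symmetric] by simp
    also have "2 ^ n * ((9/10 :: real) ^ 8) ^ n = (2 * (9/10) ^ 8) ^ n"
      by (rule power_mult_distrib[symmetric])
    finally show "(\<Sum>k<2 ^ n. (increment z (1 / 2 ^ n) k - increment (y n) (1 / 2 ^ n) k)\<^sup>2)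
        \<le> 4 * C\<^sup>2 * (2 * (9/10) ^ 8) ^ n" .
  qed
qed (auto intro!: always_eventually sum_nonneg)

text \<open>The ratio of the covariation to \<open>q = covariation (y n) (y n) n\<close> has variance \<open>\<tau> / (2 ^ n * q)\<close>, which is summable
  as long as \<open>q\<close> stays above \<open>\<delta>\<close>.\<close>

lemma wiener_covariation_small:
  assumes P: "wiener_measure P" and \<tau>: "0 < \<tau>" and \<delta>: "0 < \<delta>"
  shows "AE w in P. \<forall>\<^sub>F n in sequentially. \<delta> \<le> covariation (y n) (y n) n \<longrightarrow>
    \<bar>covariation (dilate \<tau> w) (y n) n\<bar> \<le> covariation (y n) (y n) n / 8"
proof -
  interpret prob_space P using P by (simp add: wiener_measure_def)
  define q where "q n = covariation (y n) (y n) n" for n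
  define f where "f n w = (if \<delta> \<le> q n then (covariation (dilate \<tau> w) (y n) n)\<^sup>2 / (q n)\<^sup>2 else 0)" for n w
  have s: "0 < \<tau> / 2 ^ n" for n using \<tau> by simp
  have m: "integrable P (\<lambda>w. (covariation (dilate \<tau> w) (y n) n)\<^sup>2)"
    "expectation (\<lambda>w. (covariation (dilate \<tau> w) (y n) n)\<^sup>2) = \<tau> / 2 ^ n * q n" for n
    using gaussian_linear_second_moment[OF wiener_increments(1)[OF P s] s wiener_increments(2)[OF P s],
        where N = "2 ^ n" and a = "\<lambda>k. increment (y n) (1 / 2 ^ n) k"]
    by (simp_all add: covariation_dilate q_def covariation_self)
  have "AE w in P. (\<lambda>n. f n w) \<longlonglongrightarrow> 0"
  proof (rule AE_tendsto_zero_of_summable_integrals)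
    show "integrable P (f n)" for n unfolding f_def using m(1) by (cases "\<delta> \<le> q n") simp_all
    show "0 \<le> f n w" for n w by (simp add: f_def)
    show "expectation (f n) \<le> \<tau> / \<delta> * (1 / 2) ^ n" for n
    proof (cases "\<delta> \<le> q n")
      case True
      have "f n = (\<lambda>w. (covariation (dilate \<tau> w) (y n) n)\<^sup>2 / (q n)\<^sup>2)"
        using True by (simp add: f_def fun_eq_iff)
      then have "expectation (f n) = \<tau> / 2 ^ n * q n / (q n)\<^sup>2" using m(2)[of n] by simp
      also have "\<dots> = \<tau> / q n * (1 / 2) ^ n"
        using True \<delta> by (simp add: power2_eq_square power_one_over)
      also have "\<dots> \<le> \<tau> / \<delta> * (1 / 2) ^ n"
        using True \<delta> \<tau> by (intro mult_right_mono divide_left_mono) auto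
      finally show ?thesis .
    next
      case False
      then have "f n = (\<lambda>w. 0)" by (simp add: f_def fun_eq_iff)
      then show ?thesis using \<tau> \<delta> by simp
    qed
    show "summable (\<lambda>n. \<tau> / \<delta> * (1 / 2) ^ n)" by (intro summable_mult summable_geometric) simp
  qed
  then show ?thesis
  proof eventually_elim
    fix w assume "(\<lambda>n. f n w) \<longlonglongrightarrow> 0"
    then have "\<forall>\<^sub>F n in sequentially. f n w < (1 / 8)\<^sup>2" by (rule order_tendstoD) simp
    then show "\<forall>\<^sub>F n in sequentially. \<delta> \<le> covariation (y n) (y n) n \<longrightarrow>
        \<bar>covariation (dilate \<tau> w) (y n) n\<bar> \<le> covariation (y n) (y n) n / 8"
    proof eventually_elim
      fix n assume f: "f n w < (1 / 8)\<^sup>2"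
      show "\<delta> \<le> covariation (y n) (y n) n \<longrightarrow>
        \<bar>covariation (dilate \<tau> w) (y n) n\<bar> \<le> covariation (y n) (y n) n / 8"
      proof
        assume d: "\<delta> \<le> covariation (y n) (y n) n"
        let ?c = "covariation (dilate \<tau> w) (y n) n"
        have q: "0 < q n" using d \<delta> by (simp add: q_def)
        have "(\<bar>?c\<bar> / q n)\<^sup>2 < (1 / 8)\<^sup>2" using f d by (simp add: f_def q_def power_divide)
        then have "\<bar>?c\<bar> / q n < 1 / 8" by (rule power_less_imp_less_base) simp
        then have "\<bar>?c\<bar> \<le> q n / 8" using q by (simp add: pos_divide_less_eq)
        then show "\<bar>?c\<bar> \<le> covariation (y n) (y n) n / 8" by (simp add: q_def)
      qed
    qed
  qed
qed

text \<open>Whenever, for large \<open>n\<close>, the level \<open>n\<close> quadratic variation of \<open>dilate \<tau> h\<close> reaches \<open>4 * \<delta>\<close>, the candidate next to \<open>\<tau>\<close> is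
  detected in the shifted path: in units of its quadratic variation, \<open>dilate \<tau> h\<close> contributes at least
  \<open>5/8\<close> to the covariation and the Brownian path takes away at most \<open>1/8\<close>.\<close>

lemma quadratic_variation_small:
  assumes P: "wiener_measure P" and \<tau>: "0 < \<tau>" and \<delta>: "0 < \<delta>"
    and mod: "\<And>n s t. n\<^sub>0 \<le> n \<Longrightarrow> 0 \<le> s \<Longrightarrow> s \<le> t \<Longrightarrow> t \<le> \<tau> \<Longrightarrow> t - s \<le> 1 / 2 ^ n \<Longrightarrow>
      \<bar>h t - h s\<bar> \<le> C * (9/10) ^ n"
    and und: "AE w in P. undetected h \<delta> (dilate \<tau> (\<lambda>t. w t + h t))"
  shows "\<forall>\<^sub>F n in sequentially. covariation (dilate \<tau> h) (dilate \<tau> h) n < 4 * \<delta>"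
proof -
  interpret prob_space P using P by (simp add: wiener_measure_def)
  define y where "y n = dilate (dyadic_floor (4 * n) \<tau>) h" for n
  have "AE w in P. \<forall>\<^sub>F n in sequentially. \<delta> \<le> covariation (y n) (y n) n \<longrightarrow>
      \<bar>covariation (dilate \<tau> w) (y n) n\<bar> \<le> covariation (y n) (y n) n / 8"
    by (rule wiener_covariation_small[OF P \<tau> \<delta>])
  with und have AE: "AE w in P. undetected h \<delta> (dilate \<tau> (\<lambda>t. w t + h t)) \<and>
      (\<forall>\<^sub>F n in sequentially. \<delta> \<le> covariation (y n) (y n) n \<longrightarrow>
        \<bar>covariation (dilate \<tau> w) (y n) n\<bar> \<le> covariation (y n) (y n) n / 8)" (is "AE w in P. ?good w")
    by eventually_elim simp
  obtain w where "?good w"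
  proof (rule ccontr)
    assume "\<not> thesis"
    then have "\<not> ?good w" for w using that by blast
    then have "AE w in P. False" by (intro eventually_mono[OF AE]) blast
    then show False by simp
  qed
  then have und': "undetected h \<delta> (dilate \<tau> (\<lambda>t. w t + h t))"
    and noise: "\<forall>\<^sub>F n in sequentially. \<delta> \<le> covariation (y n) (y n) n \<longrightarrow>
      \<bar>covariation (dilate \<tau> w) (y n) n\<bar> \<le> covariation (y n) (y n) n / 8"
    by simp_all
  obtain n1 where n1: "\<And>n j. n1 \<le> n \<Longrightarrow> j \<le> n * 16 ^ n \<Longrightarrow>
      \<delta> \<le> covariation (dilate (real j / 16 ^ n) h) (dilate (real j / 16 ^ n) h) n \<Longrightarrow>
      covariation (dilate \<tau> (\<lambda>t. w t + h t)) (dilate (real j / 16 ^ n) h) n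
        < covariation (dilate (real j / 16 ^ n) h) (dilate (real j / 16 ^ n) h) n / 2"
    using und' unfolding undetected_def Let_def by meson
  obtain n2 :: nat where n2: "\<tau> \<le> real n2" using real_arch_simple by blast
  have "\<forall>\<^sub>F n in sequentially. (\<Sum>k<2 ^ n. (increment (dilate \<tau> h) (1 / 2 ^ n) k
      - increment (y n) (1 / 2 ^ n) k)\<^sup>2) < \<delta> / 8"
    unfolding y_def by (rule order_tendstoD[OF net_approximation[OF mod \<tau>]]) (use \<delta> in auto)
  moreover have "\<forall>\<^sub>F n in sequentially. max n1 n2 \<le> n" by (rule eventually_ge_at_top)
  ultimately show ?thesis using noise
  proof eventually_elim
    fix n
    assume close: "(\<Sum>k<2 ^ n. (increment (dilate \<tau> h) (1 / 2 ^ n) k - increment (y n) (1 / 2 ^ n) k)\<^sup>2) < \<delta> / 8"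
      and n: "max n1 n2 \<le> n"
      and noise: "\<delta> \<le> covariation (y n) (y n) n \<longrightarrow>
        \<bar>covariation (dilate \<tau> w) (y n) n\<bar> \<le> covariation (y n) (y n) n / 8"
    show "covariation (dilate \<tau> h) (dilate \<tau> h) n < 4 * \<delta>"
    proof (rule ccontr)
      assume "\<not> ?thesis"
      then have *: "\<delta> \<le> covariation (y n) (y n) n"
        "5 / 8 * covariation (y n) (y n) n \<le> covariation (dilate \<tau> h) (y n) n"
        using covariation_close[OF less_imp_le[OF close] _ \<delta>] by auto
      define j where "j = nat \<lfloor>16 ^ n * \<tau>\<rfloor>"
      have p16: "(2::real) ^ (4 * n) = 16 ^ n" by (simp add: power_mult)
      have y: "y n = dilate (real j / 16 ^ n) h"
        using \<tau> by (simp add: y_def j_def dyadic_floor_eq_nat p16)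
      have "16 ^ n * \<tau> \<le> 16 ^ n * real n" using n2 n by (intro mult_left_mono) auto
      also have "\<dots> = real (n * 16 ^ n)" by simp
      finally have "j \<le> n * 16 ^ n" unfolding j_def by linarith
      then have "covariation (dilate \<tau> (\<lambda>t. w t + h t)) (y n) n < covariation (y n) (y n) n / 2"
        using n1[of n j] n *(1) unfolding y by auto
      then show False
        using * noise unfolding covariation_dilate_add_left by linarith
    qed
  qed
qed

section \<open>Quadratic variation as a clock\<close>

lemma wiener_quadratic_variation:
  assumes P: "wiener_measure P" and \<tau>: "0 < \<tau>"
  shows "AE w in P. (\<lambda>n. covariation (dilate \<tau> w) (dilate \<tau> w) n) \<longlonglongrightarrow> \<tau>"
proof -
  interpret prob_space P using P by (simp add: wiener_measure_def)
  define f where "f n w = (covariation (dilate \<tau> w) (dilate \<tau> w) n - \<tau>)\<^sup>2" for n w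
  have s: "0 < \<tau> / 2 ^ n" for n using \<tau> by simp
  have m: "integrable P (f n)" "expectation (f n) = 2 * (\<tau> / 2 ^ n)\<^sup>2 * 2 ^ n" for n
    using gaussian_quadratic_second_moment[OF wiener_increments(1)[OF P s[of n]] s[of n]
        wiener_increments(2)[OF P s[of n]], where N = "2 ^ n"]
    by (simp_all add: f_def[abs_def] covariation_self increment_dilate)
  have "AE w in P. (\<lambda>n. f n w) \<longlonglongrightarrow> 0"
  proof (rule AE_tendsto_zero_of_summable_integrals[OF m(1)])
    show "0 \<le> f n w" for n w by (simp add: f_def)
    show "expectation (f n) \<le> 2 * \<tau>\<^sup>2 * (1 / 2) ^ n" for n
      unfolding m(2) by (simp add: power_divide power2_eq_square)
    show "summable (\<lambda>n. 2 * \<tau>\<^sup>2 * (1 / 2) ^ n)" by (intro summable_mult summable_geometric) simp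
  qed
  then show ?thesis
  proof eventually_elim
    fix w assume "(\<lambda>n. f n w) \<longlonglongrightarrow> 0"
    then have "(\<lambda>n. \<bar>covariation (dilate \<tau> w) (dilate \<tau> w) n - \<tau>\<bar>) \<longlonglongrightarrow> 0"
      using tendsto_real_sqrt[of "\<lambda>n. f n w" 0 sequentially] by (simp add: f_def)
    then have "(\<lambda>n. covariation (dilate \<tau> w) (dilate \<tau> w) n - \<tau>) \<longlonglongrightarrow> 0"
      by (rule tendsto_rabs_zero_cancel)
    then show "(\<lambda>n. covariation (dilate \<tau> w) (dilate \<tau> w) n) \<longlonglongrightarrow> \<tau>"
      by (simp add: LIM_zero_iff)
  qed
qed

text \<open>By the Cauchy-Schwarz inequality the mixed term vanishes in the limit as well.\<close>

lemma quadratic_variation_shift: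
  assumes w: "(\<lambda>n. covariation (dilate \<tau> w) (dilate \<tau> w) n) \<longlonglongrightarrow> \<tau>"
    and h: "(\<lambda>n. covariation (dilate \<tau> h) (dilate \<tau> h) n) \<longlonglongrightarrow> 0"
  shows "(\<lambda>n. covariation (dilate \<tau> (\<lambda>t. w t + h t)) (dilate \<tau> (\<lambda>t. w t + h t)) n) \<longlonglongrightarrow> \<tau>"
proof -
  let ?w = "dilate \<tau> w" and ?h = "dilate \<tau> h"
  have cs: "(covariation ?w ?h n)\<^sup>2 \<le> covariation ?w ?w n * covariation ?h ?h n" for n
    unfolding covariation_self unfolding covariation_def by (rule Cauchy_Schwarz_ineq_sum)
  have lim: "(\<lambda>n. covariation ?w ?w n * covariation ?h ?h n) \<longlonglongrightarrow> 0"
    using tendsto_mult[OF w h] by simp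
  have "(\<lambda>n. (covariation ?w ?h n)\<^sup>2) \<longlonglongrightarrow> 0"
    by (rule tendsto_sandwich[OF _ _ tendsto_const lim]) (simp_all add: cs)
  then have "(\<lambda>n. \<bar>covariation ?w ?h n\<bar>) \<longlonglongrightarrow> 0"
    using tendsto_real_sqrt[of "\<lambda>n. (covariation ?w ?h n)\<^sup>2" 0 sequentially] by simp
  then have c: "(\<lambda>n. covariation ?w ?h n) \<longlonglongrightarrow> 0" by (rule tendsto_rabs_zero_cancel)
  have "covariation (dilate \<tau> (\<lambda>t. w t + h t)) (dilate \<tau> (\<lambda>t. w t + h t)) n
      = covariation ?w ?w n + 2 * covariation ?w ?h n + covariation ?h ?h n" for n
    unfolding covariation_def sum_distrib_left sum.distrib[symmetric]
    by (intro sum.cong refl) (simp add: increment_dilate_add algebra_simps)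
  moreover have "(\<lambda>n. covariation ?w ?w n + 2 * covariation ?w ?h n + covariation ?h ?h n) \<longlonglongrightarrow> \<tau> + 2 * 0 + 0"
    by (intro tendsto_intros w c h)
  ultimately show ?thesis by simp
qed

text \<open>The limit is an arbitrary number for paths without quadratic variation; the absolute value
  ensures that paths are only evaluated at nonnegative times even then.\<close>

definition clock :: "(real \<Rightarrow> real) \<Rightarrow> real" where
  "clock x = \<bar>lim (\<lambda>n. covariation x x n)\<bar>"

text \<open>The pairing of \<open>x(\<cdot> / T)\<close> with \<open>h\<close> in the inner product of the interpolations at level \<open>n\<close>, normalised to
  take the value \<open>1\<close> for \<open>x = h\<close> and \<open>T = 1\<close>.\<close>

definition matched_filter :: "(real \<Rightarrow> real) \<Rightarrow> nat \<Rightarrow> real \<Rightarrow> (real \<Rightarrow> real) \<Rightarrow> real" where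
  "matched_filter h n T x = (\<Sum>k<n * 2 ^ n. 2 ^ n * increment h (1 / 2 ^ n) k * increment x (1 / 2 ^ n / T) k)
     / dyadic_energy h n"

lemma measurable_clock: "clock \<in> borel_measurable path_borel"
  unfolding clock_def[abs_def]
  by (rule borel_measurable_abs[OF borel_measurable_lim_metric[OF measurable_covariation_self]])

lemma measurable_matched_filter: "(\<lambda>x. matched_filter h n (clock x) x) \<in> borel_measurable path_borel"
proof -
  note [measurable] = measurable_clock
  have ev: "(\<lambda>x. x (real k * (1 / 2 ^ n / clock x))) \<in> borel_measurable path_borel" for k
    by (rule measurable_eval_at_time[of "\<lambda>x. x"]) (measurable, simp add: clock_def)
  show ?thesis
    unfolding matched_filter_def increment_def
    by (intro borel_measurable_divide borel_measurable_sum borel_measurable_times borel_measurable_diff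
        borel_measurable_const ev)
qed

lemma matched_filter_dilate:
  assumes "0 < \<tau>"
  shows "matched_filter h n \<tau> (dilate \<tau> x) = matched_filter h n 1 x"
  using assms by (simp add: matched_filter_def increment_dilate)

lemma matched_filter_add:
  "matched_filter h n T (\<lambda>t. x t + y t) = matched_filter h n T x + matched_filter h n T y"
  by (simp add: matched_filter_def increment_add distrib_left sum.distrib add_divide_distrib)

lemma matched_filter_self: "dyadic_energy h n \<noteq> 0 \<Longrightarrow> matched_filter h n 1 h = 1"
  by (simp add: matched_filter_def dyadic_energy_def power2_eq_square mult.assoc)

text \<open>For a Brownian path the filter has variance \<open>1 / dyadic_energy h n\<close>, which is at most \<open>1 / 2 ^ i\<close> along the
  chosen levels.\<close>

lemma wiener_matched_filter:
  assumes P: "wiener_measure P" and m: "\<And>i. 2 ^ i \<le> dyadic_energy h (m i)"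
  shows "AE w in P. (\<lambda>i. matched_filter h (m i) 1 w) \<longlonglongrightarrow> 0"
proof -
  interpret prob_space P using P by (simp add: wiener_measure_def)
  define f where "f i w = (matched_filter h (m i) 1 w)\<^sup>2" for i w
  define e where "e i = dyadic_energy h (m i)" for i
  have e: "0 < e i" "2 ^ i \<le> e i" for i using less_le_trans[OF _ m[of i], of 0] m[of i] by (simp_all add: e_def)
  have mom: "integrable P (f i)" "expectation (f i) = 1 / e i" for i
  proof -
    let ?n = "m i"
    have s: "(0::real) < 1 / 2 ^ ?n" by simp
    note g = gaussian_linear_second_moment[OF wiener_increments(1)[OF P s] s wiener_increments(2)[OF P s],
        where N = "?n * 2 ^ ?n" and a = "\<lambda>k. 2 ^ ?n * increment h (1 / 2 ^ ?n) k"]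
    have f: "f i = (\<lambda>w. (\<Sum>k<?n * 2 ^ ?n. 2 ^ ?n * increment h (1 / 2 ^ ?n) k * increment w (1 / 2 ^ ?n) k)\<^sup>2 / (e i)\<^sup>2)"
      by (simp add: f_def fun_eq_iff matched_filter_def e_def power_divide)
    have "1 / 2 ^ ?n * (\<Sum>k<?n * 2 ^ ?n. (2 ^ ?n * increment h (1 / 2 ^ ?n) k)\<^sup>2) = e i"
      unfolding e_def dyadic_energy_def sum_distrib_left
      by (intro sum.cong refl) (simp add: power_mult_distrib power2_eq_square)
    then show "integrable P (f i)" "expectation (f i) = 1 / e i"
      unfolding f using g e(1)[of i] by (simp_all add: power2_eq_square)
  qed
  have "AE w in P. (\<lambda>i. f i w) \<longlonglongrightarrow> 0"
  proof (rule AE_tendsto_zero_of_summable_integrals[OF mom(1)])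
    show "0 \<le> f i w" for i w by (simp add: f_def)
    show "expectation (f i) \<le> (1 / 2) ^ i" for i
      unfolding mom(2) using e[of i] by (simp add: power_one_over frac_le)
    show "summable (\<lambda>i. (1 / 2 :: real) ^ i)" by (rule summable_geometric) simp
  qed
  then show ?thesis
  proof eventually_elim
    fix w assume "(\<lambda>i. f i w) \<longlonglongrightarrow> 0"
    then have "(\<lambda>i. \<bar>matched_filter h (m i) 1 w\<bar>) \<longlonglongrightarrow> 0"
      using tendsto_real_sqrt[of "\<lambda>i. f i w" 0 sequentially] by (simp add: f_def)
    then show "(\<lambda>i. matched_filter h (m i) 1 w) \<longlonglongrightarrow> 0" by (rule tendsto_rabs_zero_cancel)
  qed
qed

context
  fixes h :: "real \<Rightarrow> real" and P :: "(real \<Rightarrow> real) measure" and Q :: "real measure"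
  assumes P: "wiener_measure P" and Q: "prob_space Q" "sets Q = sets (restrict_space borel {0..})"
    and pos: "AE \<tau> in Q. 0 < \<tau>" and h: "h \<in> path_space"
    and ac: "absolutely_continuous (X_law P Q) (X_shifted_law P Q h)"
begin

lemma transfer_to_shifted:
  assumes A: "Measurable.pred path_borel A"
    and W: "\<And>\<tau>. 0 < \<tau> \<Longrightarrow> AE w in P. A (dilate \<tau> w)"
  shows "AE \<tau> in Q. AE w in P. A (dilate \<tau> (\<lambda>t. w t + h t))"
proof (rule X_law_transfer[OF P Q h ac A])
  show "AE \<tau> in Q. AE w in P. A (dilate \<tau> w)" using pos by eventually_elim (rule W)
qed

text \<open>One time scale \<open>\<tau>\<close> and one Brownian path for which both \<open>w\<close> and \<open>w + h\<close> are regular suffice, and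
  they exist because an event of full measure is not empty.\<close>

lemma shift_modulus_of_continuity:
  "\<exists>C n\<^sub>0. \<forall>n\<ge>n\<^sub>0. \<forall>s t. 0 \<le> s \<longrightarrow> s \<le> t \<longrightarrow> t \<le> T \<longrightarrow> t - s \<le> 1 / 2 ^ n \<longrightarrow>
     \<bar>h t - h s\<bar> \<le> C * (9/10) ^ n"
proof -
  interpret Q: prob_space Q by (rule Q)
  interpret P: prob_space P using P by (simp add: wiener_measure_def)
  have "AE \<tau> in Q. AE w in P. dyadically_regular (dilate \<tau> (\<lambda>t. w t + h t))"
    by (rule transfer_to_shifted[OF measurable_dyadically_regular]) (rule wiener_dyadically_regular[OF P])
  with pos have AE: "AE \<tau> in Q. 0 < \<tau> \<and> (AE w in P. dyadically_regular (dilate \<tau> (\<lambda>t. w t + h t)))"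
    by eventually_elim simp
  have "\<exists>\<tau>. 0 < \<tau> \<and> (AE w in P. dyadically_regular (dilate \<tau> (\<lambda>t. w t + h t)))" (is "\<exists>\<tau>. ?R \<tau>")
  proof (rule ccontr)
    assume "\<not> (\<exists>\<tau>. ?R \<tau>)"
    then have "AE \<tau> in Q. False" by (intro eventually_mono[OF AE]) blast
    then show False by simp
  qed
  then obtain \<tau> where \<tau>: "0 < \<tau>" and reg: "AE w in P. dyadically_regular (dilate \<tau> (\<lambda>t. w t + h t))" by blast
  from wiener_dyadically_regular[OF P \<tau>] reg
  have AE: "AE w in P. dyadically_regular (dilate \<tau> w) \<and> dyadically_regular (dilate \<tau> (\<lambda>t. w t + h t))"
    by eventually_elim simp
  have "\<exists>w. dyadically_regular (dilate \<tau> w) \<and> dyadically_regular (dilate \<tau> (\<lambda>t. w t + h t))" (is "\<exists>w. ?R w")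
  proof (rule ccontr)
    assume "\<not> (\<exists>w. ?R w)"
    then have "AE w in P. False" by (intro eventually_mono[OF AE]) blast
    then show False by simp
  qed
  then show ?thesis using modulus_of_continuity[OF h \<tau>] by blast
qed

text \<open>Brownian paths do not detect \<open>h\<close>, hence neither do the shifted paths, for each of the thresholds
  \<open>1 / (i + 1)\<close>. By \<open>quadratic_variation_small\<close> this is only possible for small quadratic variation of \<open>h\<close>.\<close>

lemma shift_quadratic_variation:
  "AE \<tau> in Q. (\<lambda>n. covariation (dilate \<tau> h) (dilate \<tau> h) n) \<longlonglongrightarrow> 0"
proof -
  have "AE \<tau> in Q. AE w in P. undetected h (1 / real (Suc i)) (dilate \<tau> (\<lambda>t. w t + h t))" for i
    by (rule transfer_to_shifted[OF measurable_undetected]) (rule wiener_undetected[OF P], simp_all)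
  then have "AE \<tau> in Q. \<forall>i. AE w in P. undetected h (1 / real (Suc i)) (dilate \<tau> (\<lambda>t. w t + h t))"
    unfolding AE_all_countable by blast
  with pos show ?thesis
  proof eventually_elim
    fix \<tau> assume \<tau>: "0 < \<tau>" and und: "\<forall>i. AE w in P. undetected h (1 / real (Suc i)) (dilate \<tau> (\<lambda>t. w t + h t))"
    obtain C n0 where mod: "\<And>n s t. n0 \<le> n \<Longrightarrow> 0 \<le> s \<Longrightarrow> s \<le> t \<Longrightarrow> t \<le> \<tau> \<Longrightarrow> t - s \<le> 1 / 2 ^ n \<Longrightarrow>
        \<bar>h t - h s\<bar> \<le> C * (9/10) ^ n"
      using shift_modulus_of_continuity[of \<tau>] by blast
    show "(\<lambda>n. covariation (dilate \<tau> h) (dilate \<tau> h) n) \<longlonglongrightarrow> 0"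
    proof (rule order_tendstoI)
      fix a :: real assume "a < 0"
      then show "\<forall>\<^sub>F n in sequentially. a < covariation (dilate \<tau> h) (dilate \<tau> h) n"
        by (intro always_eventually allI less_le_trans[OF _ covariation_self_nonneg])
    next
      fix a :: real assume "0 < a"
      then obtain i where "inverse (real (Suc i)) < a / 4" using reals_Archimedean[of "a / 4"] by auto
      then have i: "4 * (1 / real (Suc i)) < a" by (simp add: inverse_eq_divide)
      have "\<forall>\<^sub>F n in sequentially. covariation (dilate \<tau> h) (dilate \<tau> h) n < 4 * (1 / real (Suc i))"
        by (rule quadratic_variation_small[OF P \<tau> _ mod]) (use und in auto)
      then show "\<forall>\<^sub>F n in sequentially. covariation (dilate \<tau> h) (dilate \<tau> h) n < a"
        by eventually_elim (use i in linarith)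
    qed
  qed
qed

text \<open>Almost surely the clock shows the time scale \<open>\<tau>\<close> both for Brownian and for shifted paths, so that the
  filter is applied to \<open>w\<close> and to \<open>w + h\<close> themselves. If the energies were unbounded, it would tend to \<open>0\<close> for
  the former and to \<open>1\<close> for the latter along suitable levels.\<close>

lemma shift_energy_bounded: "\<exists>B. \<forall>n. dyadic_energy h n \<le> B"
proof (rule ccontr)
  assume unb: "\<not> ?thesis"
  interpret Q: prob_space Q by (rule Q)
  interpret P: prob_space P using P by (simp add: wiener_measure_def)
  have "\<exists>n. 2 ^ i \<le> dyadic_energy h n" for i :: nat using unb by (meson linear)
  then obtain m where m: "\<And>i. 2 ^ i \<le> dyadic_energy h (m i)" by metis
  define A where "A x = (\<exists>i\<^sub>0. \<forall>i\<ge>i\<^sub>0. matched_filter h (m i) (clock x) x < 1 / 2)" for x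
  note [measurable] = measurable_matched_filter
  have A: "Measurable.pred path_borel A" unfolding A_def[abs_def] by measurable
  have clock: "clock x = \<tau>" if "(\<lambda>n. covariation x x n) \<longlonglongrightarrow> \<tau>" "0 < \<tau>" for x \<tau>
    using that by (simp add: clock_def limI)
  have "AE w in P. A (dilate \<tau> w)" if \<tau>: "0 < \<tau>" for \<tau>
    using wiener_quadratic_variation[OF P \<tau>] wiener_matched_filter[OF P m]
  proof eventually_elim
    fix w assume qv: "(\<lambda>n. covariation (dilate \<tau> w) (dilate \<tau> w) n) \<longlonglongrightarrow> \<tau>"
      and mf: "(\<lambda>i. matched_filter h (m i) 1 w) \<longlonglongrightarrow> 0"
    have "\<forall>\<^sub>F i in sequentially. matched_filter h (m i) 1 w < 1 / 2"
      by (rule order_tendstoD[OF mf]) simp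
    then show "A (dilate \<tau> w)"
      by (simp add: A_def clock[OF qv \<tau>] matched_filter_dilate[OF \<tau>] eventually_sequentially)
  qed
  from transfer_to_shifted[OF A this]
  have "AE \<tau> in Q. AE w in P. A (dilate \<tau> (\<lambda>t. w t + h t))" .
  with pos shift_quadratic_variation have "AE \<tau> in Q. False"
  proof eventually_elim
    fix \<tau> assume \<tau>: "0 < \<tau>" and qh: "(\<lambda>n. covariation (dilate \<tau> h) (dilate \<tau> h) n) \<longlonglongrightarrow> 0"
      and "AE w in P. A (dilate \<tau> (\<lambda>t. w t + h t))"
    from this(3) wiener_quadratic_variation[OF P \<tau>] wiener_matched_filter[OF P m]
    have "AE w in P. False"
    proof eventually_elim
      fix w assume a: "A (dilate \<tau> (\<lambda>t. w t + h t))"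
        and qw: "(\<lambda>n. covariation (dilate \<tau> w) (dilate \<tau> w) n) \<longlonglongrightarrow> \<tau>"
        and mf: "(\<lambda>i. matched_filter h (m i) 1 w) \<longlonglongrightarrow> 0"
      have ne: "dyadic_energy h (m i) \<noteq> 0" for i
        using less_le_trans[OF _ m[of i], of 0] by simp
      have "(\<lambda>i. matched_filter h (m i) 1 w + 1) \<longlonglongrightarrow> 0 + 1" by (intro tendsto_intros mf)
      then have "\<forall>\<^sub>F i in sequentially. 1 / 2 < matched_filter h (m i) 1 w + 1"
        by (rule order_tendstoD) simp
      moreover have "\<forall>\<^sub>F i in sequentially. matched_filter h (m i) 1 w + 1 < 1 / 2"
        using a by (simp add: A_def clock[OF quadratic_variation_shift[OF qw qh] \<tau>]
            matched_filter_dilate[OF \<tau>] matched_filter_add matched_filter_self[OF ne] eventually_sequentially)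
      ultimately have "\<forall>\<^sub>F i in sequentially. False" by eventually_elim linarith
      then show False by simp
    qed
    then show False by simp
  qed
  then show False by simp
qed

end

theorem theorem3p3:
  fixes \<beta> :: real and h :: "real \<Rightarrow> real"
    and P :: "(real \<Rightarrow> real) measure" and Q :: "real measure"
  assumes "0 < \<beta>" and "\<beta> < 1"
    and "wiener_measure P"
    and "Y_law \<beta> Q"
    and "h \<in> path_space"
    and "equivalent_measures (X_law P Q) (X_shifted_law P Q h)"
  shows "h \<in> cameron_martin_space"
proof -
  have "\<exists>B. \<forall>n. dyadic_energy h n \<le> B"
    using assms(6) unfolding equivalent_measures_def
    by (intro shift_energy_bounded[OF assms(3) Y_law_properties[OF assms(4)] assms(5)]) simp
  then show ?thesis using cameron_martin_of_bounded_energy[OF assms(5)] by blast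
qed

end
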